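(* Let $(\overline{M},(\varphi_\alpha,\xi_\alpha,\eta_\alpha)_{\alpha=1,2,3},\overline{g})$ be a mixed 3-Sasakian manifold and let $M$ be a totally geodesic submanifold of $\overline{M}$, tangent to the structure vector fields $\xi_1,\xi_2,\xi_3$. Then $M$ is invariant.
   Context: Set $\tau_1=\tau_2=-1$, $\tau_3=1$. A mixed 3-structure on a smooth manifold $\overline{M}$ is a triple $(\varphi_\alpha,\xi_\alpha,\eta_\alpha)$, $\alpha=1,2,3$, where $\varphi_\alpha$ is a $(1,1)$-tensor field, $\xi_\alpha$ a vector field, $\eta_\alpha$ a 1-form, such that $\varphi_\alpha^2=\tau_\alpha(-I+\eta_\alpha\otimes\xi_\alpha)$, $\eta_\alpha(\xi_\alpha)=1$ (hence $\varphi_\alpha\xi_\alpha=0$, $\eta_\alpha\circ\varphi_\alpha=0$), and for every even permutation $(\alpha,\beta,\gamma)$ of $(1,2,3)$: $\eta_\alpha(\xi_\beta)=\eta_\beta(\xi_\alpha)=0$; $\varphi_\alpha(\xi_\beta)=\tau_\beta\xi_\gamma$, $\varphi_\beta(\xi_\alpha)=-\tau_\alpha\xi_\gamma$; $\eta_\alpha\circ\varphi_\beta=-\eta_\beta\circ\varphi_\alpha=\tau_\gamma\eta_\gamma$; $\varphi_\alpha\varphi_\beta-\tau_\alpha\eta_\beta\otimes\xi_\alpha=-\varphi_\beta\varphi_\alpha+\tau_\beta\eta_\alpha\otimes\xi_\beta=\tau_\gamma\varphi_\gamma$. It is a metric mixed 3-structure if in addition there is given a semi-Riemannian metric $\overline{g}$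 with $\overline{g}(\varphi_\alpha X,\varphi_\alpha Y)=\tau_\alpha[\overline{g}(X,Y)-\varepsilon_\alpha\eta_\alpha(X)\eta_\alpha(Y)]$ for all $X,Y$ and $\alpha=1,2,3$, where $\varepsilon_\alpha=\overline{g}(\xi_\alpha,\xi_\alpha)=\pm1$. With $\overline\nabla$ the Levi-Civita connection of $\overline g$, the structure is mixed 3-Sasakian if $(\overline\nabla_X\varphi_\alpha)Y=\tau_\alpha[\overline g(X,Y)\xi_\alpha-\varepsilon_\alpha\eta_\alpha(Y)X]$ for all $X,Y$ and $\alpha=1,2,3$ (it follows that $\overline\nabla_X\xi_\alpha=-\varepsilon_\alpha\varphi_\alpha X$). All submanifolds $M$ are immersed and non-degenerate (the restriction of $\overline g$ to $TM$ is non-degenerate). $M$ is totally geodesic if its second fundamental form vanishes; $M$ is invariant if $\varphi_\alpha(T_pM)\subset T_pM$ for all $p\in M$, $\alpha=1,2,3$. "Tangent to the structure vector fields" means $\xi_{\alpha,p}\in T_pM$ for all $p\in M$, $\alpha=1,2,3$. *)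

theory Defs
  imports "HOL-Analysis.Analysis" "HOL-Library.Function_Algebras"
begin

instantiation "fun" :: (type, real_vector) real_vector
begin

definition scaleR_fun_def: "scaleR r f = (\<lambda>x. r *\<^sub>R f x)"

instance
  by standard (auto simp: scaleR_fun_def plus_fun_def fun_eq_iff algebra_simps)

end


section \<open>Smooth manifolds\<close>

text \<open>\<open>Ck_on k f S\<close> and \<open>smooth_on f S\<close> are only meant for open \<open>S\<close>.\<close>

primrec Ck_on ::
  "nat \<Rightarrow> ('e::real_normed_vector \<Rightarrow> 'f::real_normed_vector) \<Rightarrow> 'e set \<Rightarrow> bool" where
  "Ck_on 0 f S \<longleftrightarrow> continuous_on S f"
| "Ck_on (Suc k) f S \<longleftrightarrow>
     (\<forall>x\<in>S. f differentiable (at x)) \<and>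
     (\<forall>v. Ck_on k (\<lambda>x. frechet_derivative f (at x) v) S)"

definition smooth_on ::
  "('e::real_normed_vector \<Rightarrow> 'f::real_normed_vector) \<Rightarrow> 'e set \<Rightarrow> bool" where
  "smooth_on f S \<longleftrightarrow> (\<forall>k. Ck_on k f S)"

type_synonym ('m, 'e) chart = "'m set \<times> ('m \<Rightarrow> 'e)"

abbreviation chart_inv :: "('m, 'e) chart \<Rightarrow> 'e \<Rightarrow> 'm" where
  "chart_inv c \<equiv> inv_into (fst c) (snd c)"

text \<open>
  The manifold is the whole type \<open>'m\<close>; the Hausdorff property and second countability
  are provided by its type class, and its dimension is \<open>DIM('e)\<close>. The atlas need not be maximal.
\<close>

definition smooth_atlas ::
  "('m::{t2_space,second_countable_topology}, 'e::euclidean_space) chart set \<Rightarrow> bool" where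
  "smooth_atlas A \<longleftrightarrow>
     (\<Union>c\<in>A. fst c) = UNIV \<and>
     (\<forall>c\<in>A. open (fst c) \<and> open (snd c ` fst c) \<and>
        homeomorphism (fst c) (snd c ` fst c) (snd c) (chart_inv c)) \<and>
     (\<forall>c\<in>A. \<forall>c'\<in>A. smooth_on (snd c' \<circ> chart_inv c) (snd c ` (fst c \<inter> fst c')))"

definition chart_at :: "('m, 'e) chart set \<Rightarrow> 'm \<Rightarrow> ('m, 'e) chart" where
  "chart_at A p = (SOME c. c \<in> A \<and> p \<in> fst c)"

definition smooth_fun ::
  "('m::topological_space, 'e::euclidean_space) chart set \<Rightarrow> 'm set
     \<Rightarrow> ('m \<Rightarrow> 'f::real_normed_vector) \<Rightarrow> bool" where
  "smooth_fun A U f \<longleftrightarrow>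
     open U \<and> (\<forall>c\<in>A. smooth_on (f \<circ> chart_inv c) (snd c ` (fst c \<inter> U)))"

definition smooth_map ::
  "('n::topological_space, 'f::euclidean_space) chart set
     \<Rightarrow> ('m::topological_space, 'e::euclidean_space) chart set \<Rightarrow> ('n \<Rightarrow> 'm) \<Rightarrow> bool" where
  "smooth_map B A f \<longleftrightarrow>
     continuous_on UNIV f \<and>
     (\<forall>b\<in>B. \<forall>c\<in>A. smooth_on (snd c \<circ> f \<circ> chart_inv b) (snd b ` (fst b \<inter> f -` fst c)))"


section \<open>Tangent vectors and tensor fields\<close>

text \<open>
  A tangent vector at \<open>p\<close> assigns to every chart around \<open>p\<close> its coordinate vector in that
  chart, the coordinate vectors being related by the derivatives of the transition maps. The value
  at anything that is not a chart around \<open>p\<close> is normalised to 0, so that equality of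
  tangent vectors is equality of functions.
\<close>

type_synonym ('m, 'e) tvec = "('m, 'e) chart \<Rightarrow> 'e"

definition tangent_space ::
  "('m, 'e::euclidean_space) chart set \<Rightarrow> 'm \<Rightarrow> ('m, 'e) tvec set" where
  "tangent_space A p =
     {v. (\<forall>c. \<not> (c \<in> A \<and> p \<in> fst c) \<longrightarrow> v c = 0) \<and>
         (\<forall>c\<in>A. \<forall>c'\<in>A. p \<in> fst c \<inter> fst c' \<longrightarrow>
            v c' = frechet_derivative (snd c' \<circ> chart_inv c) (at (snd c p)) (v c))}"

text \<open>The tangent vector at \<open>p\<close> whose coordinate vector in the chart \<open>c\<close> is \<open>u\<close>.\<close>

definition coord_vec ::
  "('m, 'e::euclidean_space) chart set \<Rightarrow> ('m, 'e) chart \<Rightarrow> 'm \<Rightarrow> 'e \<Rightarrow> ('m, 'e) tvec" where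
  "coord_vec A c p u =
     (\<lambda>c'. if c' \<in> A \<and> p \<in> fst c'
           then frechet_derivative (snd c' \<circ> chart_inv c) (at (snd c p)) u else 0)"

definition dir_deriv ::
  "('m, 'e::euclidean_space) chart set \<Rightarrow> 'm \<Rightarrow> ('m, 'e) tvec
     \<Rightarrow> ('m \<Rightarrow> 'f::real_normed_vector) \<Rightarrow> 'f" where
  "dir_deriv A p x f =
     (let c = chart_at A p in frechet_derivative (f \<circ> chart_inv c) (at (snd c p)) (x c))"

definition differential ::
  "('n, 'f::euclidean_space) chart set \<Rightarrow> ('m, 'e::euclidean_space) chart set
     \<Rightarrow> ('n \<Rightarrow> 'm) \<Rightarrow> 'n \<Rightarrow> ('n, 'f) tvec \<Rightarrow> ('m, 'e) tvec" where
  "differential B A f p x =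
     (\<lambda>c. if c \<in> A \<and> f p \<in> fst c then dir_deriv B p x (snd c \<circ> f) else 0)"

definition vector_field_on ::
  "('m::topological_space, 'e::euclidean_space) chart set \<Rightarrow> 'm set
     \<Rightarrow> ('m \<Rightarrow> ('m, 'e) tvec) \<Rightarrow> bool" where
  "vector_field_on A U X \<longleftrightarrow>
     open U \<and> (\<forall>p\<in>U. X p \<in> tangent_space A p) \<and>
     (\<forall>c\<in>A. smooth_on (\<lambda>u. X (chart_inv c u) c) (snd c ` (fst c \<inter> U)))"

definition vector_field_near ::
  "('m::topological_space, 'e::euclidean_space) chart set \<Rightarrow> 'm
     \<Rightarrow> ('m \<Rightarrow> ('m, 'e) tvec) \<Rightarrow> bool" where
  "vector_field_near A p X \<longleftrightarrow> (\<exists>U. p \<in> U \<and> vector_field_on A U X)"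

definition lie_bracket ::
  "('m, 'e::euclidean_space) chart set \<Rightarrow> ('m \<Rightarrow> ('m, 'e) tvec) \<Rightarrow> ('m \<Rightarrow> ('m, 'e) tvec)
     \<Rightarrow> 'm \<Rightarrow> ('m, 'e) tvec" where
  "lie_bracket A X Y p =
     (\<lambda>c. if c \<in> A \<and> p \<in> fst c
          then dir_deriv A p (X p) (\<lambda>q. Y q c) - dir_deriv A p (Y p) (\<lambda>q. X q c) else 0)"

definition tensor_field_11 ::
  "('m::topological_space, 'e::euclidean_space) chart set
     \<Rightarrow> ('m \<Rightarrow> ('m, 'e) tvec \<Rightarrow> ('m, 'e) tvec) \<Rightarrow> bool" where
  "tensor_field_11 A F \<longleftrightarrow>
     (\<forall>p. \<forall>v\<in>tangent_space A p. F p v \<in> tangent_space A p) \<and>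
     (\<forall>p. \<forall>v\<in>tangent_space A p. \<forall>w\<in>tangent_space A p. F p (v + w) = F p v + F p w) \<and>
     (\<forall>p. \<forall>v\<in>tangent_space A p. \<forall>r::real. F p (r *\<^sub>R v) = r *\<^sub>R F p v) \<and>
     (\<forall>U X. vector_field_on A U X \<longrightarrow> vector_field_on A U (\<lambda>p. F p (X p)))"

definition one_form ::
  "('m::topological_space, 'e::euclidean_space) chart set
     \<Rightarrow> ('m \<Rightarrow> ('m, 'e) tvec \<Rightarrow> real) \<Rightarrow> bool" where
  "one_form A w \<longleftrightarrow>
     (\<forall>p. \<forall>u\<in>tangent_space A p. \<forall>v\<in>tangent_space A p. w p (u + v) = w p u + w p v) \<and>
     (\<forall>p. \<forall>v\<in>tangent_space A p. \<forall>r::real. w p (r *\<^sub>R v) = r * w p v) \<and>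
     (\<forall>U X. vector_field_on A U X \<longrightarrow> smooth_fun A U (\<lambda>p. w p (X p)))"


section \<open>Semi-Riemannian metrics and the Levi-Civita connection\<close>

definition nondegenerate_on ::
  "('v \<Rightarrow> 'v \<Rightarrow> real) \<Rightarrow> 'v::real_vector set \<Rightarrow> bool" where
  "nondegenerate_on b W \<longleftrightarrow> (\<forall>v\<in>W. (\<forall>w\<in>W. b v w = 0) \<longrightarrow> v = 0)"

definition index_on :: "('v \<Rightarrow> 'v \<Rightarrow> real) \<Rightarrow> 'v::real_vector set \<Rightarrow> nat" where
  "index_on b W = Max {dim S |S. subspace S \<and> S \<subseteq> W \<and> (\<forall>v\<in>S - {0}. b v v < 0)}"

definition semi_riemannian_metric ::
  "('m::topological_space, 'e::euclidean_space) chart set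
     \<Rightarrow> ('m \<Rightarrow> ('m, 'e) tvec \<Rightarrow> ('m, 'e) tvec \<Rightarrow> real) \<Rightarrow> bool" where
  "semi_riemannian_metric A g \<longleftrightarrow>
     (\<forall>p. \<forall>u\<in>tangent_space A p. \<forall>v\<in>tangent_space A p. g p u v = g p v u) \<and>
     (\<forall>p. \<forall>u\<in>tangent_space A p. \<forall>v\<in>tangent_space A p. \<forall>w\<in>tangent_space A p.
        g p (u + v) w = g p u w + g p v w) \<and>
     (\<forall>p. \<forall>v\<in>tangent_space A p. \<forall>w\<in>tangent_space A p. \<forall>r::real.
        g p (r *\<^sub>R v) w = r * g p v w) \<and>
     (\<forall>U X Y. vector_field_on A U X \<longrightarrow> vector_field_on A U Y \<longrightarrow>
        smooth_fun A U (\<lambda>p. g p (X p) (Y p))) \<and>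
     (\<forall>p. nondegenerate_on (g p) (tangent_space A p)) \<and>
     (\<exists>\<nu>. \<forall>p. index_on (g p) (tangent_space A p) = \<nu>)"

text \<open>
  A connection is an operator \<open>nab p x Y\<close>, the covariant derivative at \<open>p\<close> in the direction of
  the tangent vector \<open>x\<close> of a vector field \<open>Y\<close> that need only be defined and smooth on some
  neighbourhood of \<open>p\<close>. Independence of the values of \<open>Y\<close> away from \<open>p\<close> is a consequence
  of the Leibniz rule, as the functions in it are also only required to be smooth near \<open>p\<close>.
\<close>

type_synonym ('m, 'e) conn =
  "'m \<Rightarrow> ('m, 'e) tvec \<Rightarrow> ('m \<Rightarrow> ('m, 'e) tvec) \<Rightarrow> ('m, 'e) tvec"

definition affine_connection ::
  "('m::topological_space, 'e::euclidean_space) chart set \<Rightarrow> ('m, 'e) conn \<Rightarrow> bool" where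
  "affine_connection A nab \<longleftrightarrow>
     (\<forall>p Y. \<forall>x\<in>tangent_space A p. vector_field_near A p Y \<longrightarrow>
        nab p x Y \<in> tangent_space A p) \<and>
     (\<forall>p Y. \<forall>x\<in>tangent_space A p. \<forall>y\<in>tangent_space A p. vector_field_near A p Y \<longrightarrow>
        nab p (x + y) Y = nab p x Y + nab p y Y) \<and>
     (\<forall>p Y. \<forall>x\<in>tangent_space A p. \<forall>r::real. vector_field_near A p Y \<longrightarrow>
        nab p (r *\<^sub>R x) Y = r *\<^sub>R nab p x Y) \<and>
     (\<forall>p Y Z. \<forall>x\<in>tangent_space A p. vector_field_near A p Y \<longrightarrow> vector_field_near A p Z \<longrightarrow>
        nab p x (\<lambda>q. Y q + Z q) = nab p x Y + nab p x Z) \<and>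
     (\<forall>p Y. \<forall>f :: 'm \<Rightarrow> real. \<forall>x\<in>tangent_space A p.
        vector_field_near A p Y \<longrightarrow> (\<exists>U. p \<in> U \<and> smooth_fun A U f) \<longrightarrow>
        nab p x (\<lambda>q. f q *\<^sub>R Y q) = dir_deriv A p x f *\<^sub>R Y p + f p *\<^sub>R nab p x Y) \<and>
     (\<forall>U X Y. vector_field_on A U X \<longrightarrow> vector_field_on A U Y \<longrightarrow>
        vector_field_on A U (\<lambda>p. nab p (X p) Y))"

definition torsion_free ::
  "('m::topological_space, 'e::euclidean_space) chart set \<Rightarrow> ('m, 'e) conn \<Rightarrow> bool" where
  "torsion_free A nab \<longleftrightarrow>
     (\<forall>p X Y. vector_field_near A p X \<longrightarrow> vector_field_near A p Y \<longrightarrow>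
        nab p (X p) Y - nab p (Y p) X = lie_bracket A X Y p)"

definition metric_connection ::
  "('m::topological_space, 'e::euclidean_space) chart set
     \<Rightarrow> ('m \<Rightarrow> ('m, 'e) tvec \<Rightarrow> ('m, 'e) tvec \<Rightarrow> real) \<Rightarrow> ('m, 'e) conn \<Rightarrow> bool" where
  "metric_connection A g nab \<longleftrightarrow>
     (\<forall>p Y Z. \<forall>x\<in>tangent_space A p. vector_field_near A p Y \<longrightarrow> vector_field_near A p Z \<longrightarrow>
        dir_deriv A p x (\<lambda>q. g q (Y q) (Z q)) = g p (nab p x Y) (Z p) + g p (Y p) (nab p x Z))"

definition levi_civita ::
  "('m::topological_space, 'e::euclidean_space) chart set
     \<Rightarrow> ('m \<Rightarrow> ('m, 'e) tvec \<Rightarrow> ('m, 'e) tvec \<Rightarrow> real) \<Rightarrow> ('m, 'e) conn \<Rightarrow> bool" where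
  "levi_civita A g nab \<longleftrightarrow>
     affine_connection A nab \<and> torsion_free A nab \<and> metric_connection A g nab"

definition cov_deriv_11 ::
  "('m, 'e) conn \<Rightarrow> ('m \<Rightarrow> ('m, 'e) tvec \<Rightarrow> ('m, 'e) tvec)
     \<Rightarrow> 'm \<Rightarrow> ('m, 'e::euclidean_space) tvec \<Rightarrow> ('m \<Rightarrow> ('m, 'e) tvec) \<Rightarrow> ('m, 'e) tvec" where
  "cov_deriv_11 nab F p x Y = nab p x (\<lambda>q. F q (Y q)) - F p (nab p x Y)"


section \<open>Mixed 3-structures\<close>

definition \<tau> :: "nat \<Rightarrow> real" where
  "\<tau> \<alpha> = (if \<alpha> = 3 then 1 else - 1)"

definition even_perms :: "(nat \<times> nat \<times> nat) set" where
  "even_perms = {(1, 2, 3), (2, 3, 1), (3, 1, 2)}"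

definition mixed_3_structure ::
  "('m::topological_space, 'e::euclidean_space) chart set
     \<Rightarrow> (nat \<Rightarrow> 'm \<Rightarrow> ('m, 'e) tvec \<Rightarrow> ('m, 'e) tvec)
     \<Rightarrow> (nat \<Rightarrow> 'm \<Rightarrow> ('m, 'e) tvec)
     \<Rightarrow> (nat \<Rightarrow> 'm \<Rightarrow> ('m, 'e) tvec \<Rightarrow> real) \<Rightarrow> bool" where
  "mixed_3_structure A \<phi> \<xi> \<eta> \<longleftrightarrow>
     (\<forall>\<alpha>\<in>{1,2,3}.
        tensor_field_11 A (\<phi> \<alpha>) \<and> vector_field_on A UNIV (\<xi> \<alpha>) \<and> one_form A (\<eta> \<alpha>) \<and>
        (\<forall>p. \<eta> \<alpha> p (\<xi> \<alpha> p) = 1) \<and>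
        (\<forall>p. \<forall>v\<in>tangent_space A p.
           \<phi> \<alpha> p (\<phi> \<alpha> p v) = \<tau> \<alpha> *\<^sub>R (- v + \<eta> \<alpha> p v *\<^sub>R \<xi> \<alpha> p))) \<and>
     (\<forall>(\<alpha>, \<beta>, \<gamma>)\<in>even_perms. \<forall>p.
        \<eta> \<alpha> p (\<xi> \<beta> p) = 0 \<and> \<eta> \<beta> p (\<xi> \<alpha> p) = 0 \<and>
        \<phi> \<alpha> p (\<xi> \<beta> p) = \<tau> \<beta> *\<^sub>R \<xi> \<gamma> p \<and>
        \<phi> \<beta> p (\<xi> \<alpha> p) = - (\<tau> \<alpha> *\<^sub>R \<xi> \<gamma> p) \<and>
        (\<forall>v\<in>tangent_space A p.
           \<eta> \<alpha> p (\<phi> \<beta> p v) = \<tau> \<gamma> * \<eta> \<gamma> p v \<and>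
           - \<eta> \<beta> p (\<phi> \<alpha> p v) = \<tau> \<gamma> * \<eta> \<gamma> p v \<and>
           \<phi> \<alpha> p (\<phi> \<beta> p v) - (\<tau> \<alpha> * \<eta> \<beta> p v) *\<^sub>R \<xi> \<alpha> p = \<tau> \<gamma> *\<^sub>R \<phi> \<gamma> p v \<and>
           - \<phi> \<beta> p (\<phi> \<alpha> p v) + (\<tau> \<beta> * \<eta> \<alpha> p v) *\<^sub>R \<xi> \<beta> p = \<tau> \<gamma> *\<^sub>R \<phi> \<gamma> p v))"

definition metric_mixed_3_structure ::
  "('m::topological_space, 'e::euclidean_space) chart set
     \<Rightarrow> (nat \<Rightarrow> 'm \<Rightarrow> ('m, 'e) tvec \<Rightarrow> ('m, 'e) tvec)
     \<Rightarrow> (nat \<Rightarrow> 'm \<Rightarrow> ('m, 'e) tvec)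
     \<Rightarrow> (nat \<Rightarrow> 'm \<Rightarrow> ('m, 'e) tvec \<Rightarrow> real)
     \<Rightarrow> ('m \<Rightarrow> ('m, 'e) tvec \<Rightarrow> ('m, 'e) tvec \<Rightarrow> real) \<Rightarrow> bool" where
  "metric_mixed_3_structure A \<phi> \<xi> \<eta> g \<longleftrightarrow>
     mixed_3_structure A \<phi> \<xi> \<eta> \<and> semi_riemannian_metric A g \<and>
     (\<forall>\<alpha>\<in>{1,2,3}. \<forall>p.
        g p (\<xi> \<alpha> p) (\<xi> \<alpha> p) \<in> {1, - 1} \<and>
        (\<forall>v\<in>tangent_space A p. \<forall>w\<in>tangent_space A p.
           g p (\<phi> \<alpha> p v) (\<phi> \<alpha> p w) =
             \<tau> \<alpha> * (g p v w - g p (\<xi> \<alpha> p) (\<xi> \<alpha> p) * \<eta> \<alpha> p v * \<eta> \<alpha> p w)))"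

definition mixed_3_sasakian ::
  "('m::topological_space, 'e::euclidean_space) chart set
     \<Rightarrow> (nat \<Rightarrow> 'm \<Rightarrow> ('m, 'e) tvec \<Rightarrow> ('m, 'e) tvec)
     \<Rightarrow> (nat \<Rightarrow> 'm \<Rightarrow> ('m, 'e) tvec)
     \<Rightarrow> (nat \<Rightarrow> 'm \<Rightarrow> ('m, 'e) tvec \<Rightarrow> real)
     \<Rightarrow> ('m \<Rightarrow> ('m, 'e) tvec \<Rightarrow> ('m, 'e) tvec \<Rightarrow> real) \<Rightarrow> ('m, 'e) conn \<Rightarrow> bool" where
  "mixed_3_sasakian A \<phi> \<xi> \<eta> g nab \<longleftrightarrow>
     metric_mixed_3_structure A \<phi> \<xi> \<eta> g \<and> levi_civita A g nab \<and>
     (\<forall>\<alpha>\<in>{1,2,3}. \<forall>p Y. \<forall>x\<in>tangent_space A p. vector_field_near A p Y \<longrightarrow>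
        cov_deriv_11 nab (\<phi> \<alpha>) p x Y =
          \<tau> \<alpha> *\<^sub>R (g p x (Y p) *\<^sub>R \<xi> \<alpha> p - (g p (\<xi> \<alpha> p) (\<xi> \<alpha> p) * \<eta> \<alpha> p (Y p)) *\<^sub>R x))"


section \<open>Immersed submanifolds\<close>

definition immersion ::
  "('n::topological_space, 'f::euclidean_space) chart set
     \<Rightarrow> ('m::topological_space, 'e::euclidean_space) chart set \<Rightarrow> ('n \<Rightarrow> 'm) \<Rightarrow> bool" where
  "immersion B A \<iota> \<longleftrightarrow>
     smooth_map B A \<iota> \<and> (\<forall>p. inj_on (differential B A \<iota> p) (tangent_space B p))"

text \<open>The tangent space of the submanifold at \<open>p\<close>, as a subspace of the ambient tangent space.\<close>

definition sub_tangent ::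
  "('n, 'f::euclidean_space) chart set \<Rightarrow> ('m, 'e::euclidean_space) chart set
     \<Rightarrow> ('n \<Rightarrow> 'm) \<Rightarrow> 'n \<Rightarrow> ('m, 'e) tvec set" where
  "sub_tangent B A \<iota> p = differential B A \<iota> p ` tangent_space B p"

definition nondegenerate_submanifold ::
  "('n, 'f::euclidean_space) chart set \<Rightarrow> ('m, 'e::euclidean_space) chart set
     \<Rightarrow> ('m \<Rightarrow> ('m, 'e) tvec \<Rightarrow> ('m, 'e) tvec \<Rightarrow> real) \<Rightarrow> ('n \<Rightarrow> 'm) \<Rightarrow> bool" where
  "nondegenerate_submanifold B A g \<iota> \<longleftrightarrow>
     (\<forall>p. nondegenerate_on (g (\<iota> p)) (sub_tangent B A \<iota> p))"

text \<open>
  The covariant derivative of a vector field \<open>V\<close> along \<open>\<iota>\<close> (so \<open>V q\<close> is tangent to the ambient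
  manifold at \<open>\<iota> q\<close>), that is, the pull-back of the ambient connection: writing
  \<open>V = V\<^sup>b (\<partial>\<^sub>b \<circ> \<iota>)\<close> in a chart around \<open>\<iota> p\<close>, it is \<open>x(V\<^sup>b) \<partial>\<^sub>b + V\<^sup>b nab\<^bsub>d\<iota>(x)\<^esub> \<partial>\<^sub>b\<close>.
  The result does not depend on the chart.
\<close>

definition cov_deriv_along ::
  "('n, 'f::euclidean_space) chart set \<Rightarrow> ('m, 'e::euclidean_space) chart set
     \<Rightarrow> ('m, 'e) conn \<Rightarrow> ('n \<Rightarrow> 'm)
     \<Rightarrow> 'n \<Rightarrow> ('n, 'f) tvec \<Rightarrow> ('n \<Rightarrow> ('m, 'e) tvec) \<Rightarrow> ('m, 'e) tvec" where
  "cov_deriv_along B A nab \<iota> p x V =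
     (let c = chart_at A (\<iota> p) in
        coord_vec A c (\<iota> p) (dir_deriv B p x (\<lambda>q. V q c)) +
        (\<Sum>b\<in>Basis. (V p c \<bullet> b) *\<^sub>R
           nab (\<iota> p) (differential B A \<iota> p x) (\<lambda>q. coord_vec A c q b)))"

definition normal_part ::
  "('n, 'f::euclidean_space) chart set \<Rightarrow> ('m, 'e::euclidean_space) chart set
     \<Rightarrow> ('m \<Rightarrow> ('m, 'e) tvec \<Rightarrow> ('m, 'e) tvec \<Rightarrow> real) \<Rightarrow> ('n \<Rightarrow> 'm)
     \<Rightarrow> 'n \<Rightarrow> ('m, 'e) tvec \<Rightarrow> ('m, 'e) tvec" where
  "normal_part B A g \<iota> p v =
     (THE n. n \<in> tangent_space A (\<iota> p) \<and> (\<forall>w\<in>sub_tangent B A \<iota> p. g (\<iota> p) n w = 0) \<and>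
             v - n \<in> sub_tangent B A \<iota> p)"

definition second_fundamental_form ::
  "('n, 'f::euclidean_space) chart set \<Rightarrow> ('m, 'e::euclidean_space) chart set
     \<Rightarrow> ('m \<Rightarrow> ('m, 'e) tvec \<Rightarrow> ('m, 'e) tvec \<Rightarrow> real) \<Rightarrow> ('m, 'e) conn \<Rightarrow> ('n \<Rightarrow> 'm)
     \<Rightarrow> 'n \<Rightarrow> ('n, 'f) tvec \<Rightarrow> ('n \<Rightarrow> ('n, 'f) tvec) \<Rightarrow> ('m, 'e) tvec" where
  "second_fundamental_form B A g nab \<iota> p x Y =
     normal_part B A g \<iota> p (cov_deriv_along B A nab \<iota> p x (\<lambda>q. differential B A \<iota> q (Y q)))"

definition totally_geodesic ::
  "('n::topological_space, 'f::euclidean_space) chart set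
     \<Rightarrow> ('m, 'e::euclidean_space) chart set
     \<Rightarrow> ('m \<Rightarrow> ('m, 'e) tvec \<Rightarrow> ('m, 'e) tvec \<Rightarrow> real) \<Rightarrow> ('m, 'e) conn \<Rightarrow> ('n \<Rightarrow> 'm) \<Rightarrow> bool" where
  "totally_geodesic B A g nab \<iota> \<longleftrightarrow>
     (\<forall>p Y. \<forall>x\<in>tangent_space B p. vector_field_near B p Y \<longrightarrow>
        second_fundamental_form B A g nab \<iota> p x Y = 0)"

definition tangent_to_structure ::
  "('n, 'f::euclidean_space) chart set \<Rightarrow> ('m, 'e::euclidean_space) chart set
     \<Rightarrow> (nat \<Rightarrow> 'm \<Rightarrow> ('m, 'e) tvec) \<Rightarrow> ('n \<Rightarrow> 'm) \<Rightarrow> bool" where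
  "tangent_to_structure B A \<xi> \<iota> \<longleftrightarrow> (\<forall>p. \<forall>\<alpha>\<in>{1,2,3}. \<xi> \<alpha> (\<iota> p) \<in> sub_tangent B A \<iota> p)"

definition invariant_submanifold ::
  "('n, 'f::euclidean_space) chart set \<Rightarrow> ('m, 'e::euclidean_space) chart set
     \<Rightarrow> (nat \<Rightarrow> 'm \<Rightarrow> ('m, 'e) tvec \<Rightarrow> ('m, 'e) tvec) \<Rightarrow> ('n \<Rightarrow> 'm) \<Rightarrow> bool" where
  "invariant_submanifold B A \<phi> \<iota> \<longleftrightarrow>
     (\<forall>p. \<forall>\<alpha>\<in>{1,2,3}. \<phi> \<alpha> (\<iota> p) ` sub_tangent B A \<iota> p \<subseteq> sub_tangent B A \<iota> p)"

end

theory Submission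
  imports Defs
begin

text \<open>
  Applying \<open>\<phi>\<^sub>\<alpha>\<close> to the Sasakian equation for \<open>(nab\<^sub>X \<phi>\<^sub>\<alpha>) \<xi>\<^sub>\<alpha>\<close> expresses \<open>\<phi>\<^sub>\<alpha> X\<close> as a linear combination of
  \<open>nab\<^sub>X \<xi>\<^sub>\<alpha>\<close> and \<open>\<xi>\<^sub>\<alpha>\<close>, so it suffices that \<open>nab\<^sub>X \<xi>\<^sub>\<alpha>\<close> is tangent to the submanifold. The covariant
  derivative of \<open>\<xi>\<^sub>\<alpha>\<close> along \<open>\<iota>\<close> differs from that of a coordinate field of the submanifold with the
  same value at \<open>p\<close> only by the derivative of a tangent field vanishing at \<open>p\<close>, which is tangent; and
  the covariant derivative of the coordinate field is tangent because the submanifold is totally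
  geodesic. Hence smoothness of \<open>\<xi>\<^sub>\<alpha>\<close> as a vector field on the submanifold is not needed.
\<close>

section \<open>Calculus of \<open>C\<^sup>k\<close> maps\<close>

text \<open>Since \<open>S\<close> is open, the two functions agree near each of its points and so
  have the same Frechet derivatives there; the induction passes to these derivatives.\<close>

lemma Ck_on_cong:
  assumes "open S" "\<And>x. x \<in> S \<Longrightarrow> f x = g x" "Ck_on k f S"
  shows "Ck_on k g S"
  using assms(2,3)
proof (induction k arbitrary: f g)
  case 0
  then show ?case using continuous_on_cong by fastforce
next
  case (Suc k)
  have der: "(g has_derivative frechet_derivative f (at x)) (at x)" if "x \<in> S" for x
    by (rule has_derivative_transform_within_open[OF _ assms(1) that Suc.prems(1)])
      (use Suc.prems(2) that in \<open>simp_all add: frechet_derivative_works\<close>)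
  then have "frechet_derivative f (at x) = frechet_derivative g (at x)" if "x \<in> S" for x
    using frechet_derivative_at that by blast
  moreover have "g differentiable at x" if "x \<in> S" for x
    using der that differentiable_def by blast
  ultimately show ?case
    using Suc.IH[of "\<lambda>x. frechet_derivative f (at x) v" "\<lambda>x. frechet_derivative g (at x) v" for v]
      Suc.prems by auto
qed

lemma Ck_on_subset: "Ck_on k f T \<Longrightarrow> S \<subseteq> T \<Longrightarrow> Ck_on k f S"
  by (induction k arbitrary: f) (auto intro: continuous_on_subset)

lemma Ck_on_Suc_imp_Ck_on: "Ck_on (Suc k) f S \<Longrightarrow> Ck_on k f S"
proof (induction k arbitrary: f)
  case 0
  then show ?case
    by (auto intro!: continuous_at_imp_continuous_on differentiable_imp_continuous_within)
next
  case (Suc k)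
  show ?case using Suc.IH Suc.prems by (simp del: Ck_on.simps(2) add: Ck_on.simps(2)[of "Suc k"]) auto
qed

lemma Ck_on_const: "Ck_on k (\<lambda>x. a) S"
  by (induction k arbitrary: a) auto

text \<open>Allows an explicit derivative \<open>f'\<close>, as produced by the differentiation
  rules, in place of \<open>frechet_derivative\<close>; the closure properties below are inductions
  built on it.\<close>

lemma Ck_on_SucI:
  assumes "open S" and "\<And>x. x \<in> S \<Longrightarrow> (f has_derivative f' x) (at x)"
    and "\<And>v. Ck_on k (\<lambda>x. f' x v) S"
  shows "Ck_on (Suc k) f S"
proof -
  have "f' x = frechet_derivative f (at x)" if "x \<in> S" for x
    using assms(2)[OF that] frechet_derivative_at by blast
  then have "Ck_on k (\<lambda>x. frechet_derivative f (at x) v) S" for v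
    using Ck_on_cong[OF assms(1) _ assms(3)] by simp
  moreover have "f differentiable at x" if "x \<in> S" for x
    using assms(2)[OF that] by (rule differentiableI)
  ultimately show ?thesis by simp
qed

lemma Ck_on_Suc_has_derivative:
  "Ck_on (Suc k) f S \<Longrightarrow> x \<in> S \<Longrightarrow> (f has_derivative frechet_derivative f (at x)) (at x)"
  by (simp add: frechet_derivative_works)

lemma Ck_on_add:
  assumes "open S" "Ck_on k f S" "Ck_on k g S"
  shows "Ck_on k (\<lambda>x. f x + g x) S"
  using assms(2,3)
proof (induction k arbitrary: f g)
  case (Suc k)
  show ?case
    by (rule Ck_on_SucI[OF assms(1) has_derivative_add])
      (use Suc Ck_on_Suc_has_derivative in \<open>auto simp: frechet_derivative_works\<close>)
qed (auto intro: continuous_intros)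

lemma Ck_on_sum:
  assumes "open S" "\<And>i. i \<in> I \<Longrightarrow> Ck_on k (f i) S"
  shows "Ck_on k (\<lambda>x. \<Sum>i\<in>I. f i x) S"
  using assms(2)
  by (induction I rule: infinite_finite_induct) (auto intro!: Ck_on_add Ck_on_const assms(1))

text \<open>By the product rule the derivative is a sum of two terms of the same shape. This treats
  scalar multiplication and the inner product at once.\<close>

lemma Ck_on_bilinear:
  assumes "bounded_bilinear m" "open S" "Ck_on k f S" "Ck_on k g S"
  shows "Ck_on k (\<lambda>x. m (f x) (g x)) S"
  using assms(3,4)
proof (induction k arbitrary: f g)
  case 0
  then show ?case using bounded_bilinear.continuous_on[OF assms(1)] by auto
next
  case (Suc k)
  have "Ck_on k f S" "Ck_on k g S" using Suc.prems Ck_on_Suc_imp_Ck_on by blast+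
  then have "Ck_on k (\<lambda>x. m (f x) (frechet_derivative g (at x) v)
      + m (frechet_derivative f (at x) v) (g x)) S" for v
    using Suc by (intro Ck_on_add assms(2)) auto
  then show ?case
    using Suc.prems
    by (intro Ck_on_SucI[OF assms(2) bounded_bilinear.FDERIV[OF assms(1)]])
      (auto simp: frechet_derivative_works)
qed

text \<open>In the derivative \<open>?Df (g x) (?Dg x v)\<close> the direction also varies with
  \<open>x\<close>, so the induction hypothesis does not apply to it directly. Expanding the
  direction in the finite basis of \<open>'e\<close> leaves products of components of
  \<open>?Dg x v\<close> with partial derivatives of \<open>f\<close> composed with
  \<open>g\<close>.\<close>

lemma Ck_on_compose:
  fixes g :: "'d::real_normed_vector \<Rightarrow> 'e::euclidean_space"
  assumes "open S" "open T" "g ` S \<subseteq> T" "Ck_on k f T" "Ck_on k g S"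
  shows "Ck_on k (\<lambda>x. f (g x)) S"
  using assms(4,5)
proof (induction k arbitrary: f)
  case 0
  then show ?case using assms(3) continuous_on_compose2 by fastforce
next
  case (Suc k)
  let ?Df = "\<lambda>y. frechet_derivative f (at y)" and ?Dg = "\<lambda>x. frechet_derivative g (at x)"
  have Df: "(f has_derivative ?Df (g x)) (at (g x))" if "x \<in> S" for x
    using Suc.prems that assms(3) by (auto simp: frechet_derivative_works)
  have der: "((\<lambda>x. f (g x)) has_derivative (\<lambda>v. ?Df (g x) (?Dg x v))) (at x)" if "x \<in> S" for x
    by (rule has_derivative_compose[where f=g, OF _ Df[OF that]])
      (use Suc.prems that in \<open>simp add: frechet_derivative_works\<close>)
  have eq: "?Df (g x) (?Dg x v) = (\<Sum>b\<in>Basis. (?Dg x v \<bullet> b) *\<^sub>R ?Df (g x) b)" if "x \<in> S" for x v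
  proof -
    interpret linear "?Df (g x)" using Df[OF that] has_derivative_linear by blast
    show ?thesis
      by (subst euclidean_representation[of "?Dg x v", symmetric]) (simp only: sum scaleR)
  qed
  have "Ck_on k (\<lambda>x. \<Sum>b\<in>Basis. (?Dg x v \<bullet> b) *\<^sub>R ?Df (g x) b) S" for v
  proof (intro Ck_on_sum Ck_on_bilinear[OF bounded_bilinear_scaleR] assms(1)
      Ck_on_bilinear[OF bounded_bilinear_inner] Ck_on_const)
    show "Ck_on k (\<lambda>x. ?Dg x v) S" using Suc.prems by simp
    show "Ck_on k (\<lambda>x. ?Df (g x) b) S" for b
      using Suc.IH[of "\<lambda>y. ?Df y b"] Suc.prems Ck_on_Suc_imp_Ck_on by auto
  qed
  then have "Ck_on k (\<lambda>x. ?Df (g x) (?Dg x v)) S" for v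
    using Ck_on_cong[OF assms(1)] eq by (metis (no_types, lifting))
  then show ?case using Ck_on_SucI[OF assms(1) der] by blast
qed

section \<open>Maps of class C^k for every k\<close>

lemma smooth_on_has_derivative:
  "smooth_on f S \<Longrightarrow> x \<in> S \<Longrightarrow> (f has_derivative frechet_derivative f (at x)) (at x)"
  using Ck_on_Suc_has_derivative smooth_on_def by blast

lemma smooth_on_frechet_derivative:
  "smooth_on f S \<Longrightarrow> smooth_on (\<lambda>x. frechet_derivative f (at x) v) S"
  unfolding smooth_on_def by (metis Ck_on.simps(2))

lemma smooth_on_subset: "smooth_on f T \<Longrightarrow> S \<subseteq> T \<Longrightarrow> smooth_on f S"
  unfolding smooth_on_def using Ck_on_subset by blast

lemma smooth_on_cong:
  "smooth_on f S \<Longrightarrow> open S \<Longrightarrow> (\<And>x. x \<in> S \<Longrightarrow> f x = g x) \<Longrightarrow> smooth_on g S"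
  unfolding smooth_on_def using Ck_on_cong by metis

lemma smooth_on_compose:
  fixes g :: "'d::real_normed_vector \<Rightarrow> 'e::euclidean_space"
  assumes "open S" "open T" "g ` S \<subseteq> T" "smooth_on f T" "smooth_on g S"
  shows "smooth_on (\<lambda>x. f (g x)) S"
  using assms Ck_on_compose unfolding smooth_on_def by blast

section \<open>Limits of vectors in the ranges of converging linear maps\<close>

text \<open>Makes up for not knowing that the preimages \<open>z t\<close> depend continuously on the parameter.\<close>

lemma tendsto_in_range_of_injective_limit:
  fixes J :: "'t \<Rightarrow> 'f::euclidean_space \<Rightarrow> 'e::euclidean_space"
  assumes F: "F \<noteq> bot"
    and lin: "eventually (\<lambda>t. linear (J t)) F" and "linear J0" "inj J0"
    and J: "\<And>v. ((\<lambda>t. J t v) \<longlongrightarrow> J0 v) F"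
    and w: "((\<lambda>t. J t (z t)) \<longlongrightarrow> w) F"
  shows "w \<in> range J0"
proof -
  obtain L where L: "linear L" "L \<circ> J0 = id"
    using linear_injective_left_inverse assms(3,4) by blast
  interpret L: bounded_linear L using L(1) linear_conv_bounded_linear by blast
  have L_J0: "L (J0 v) = v" for v using L(2) by (metis comp_apply id_apply)
  \<comment> \<open>\<open>\<delta> t\<close> bounds the deviation of \<open>L \<circ> J t\<close>
    from the identity. It tends to 0 because \<open>J t\<close> converges on the finitely many basis
    vectors.\<close>
  define \<delta> where "\<delta> t = (\<Sum>b\<in>Basis. norm (L (J t b) - b))" for t
  have "((\<lambda>t. L (J t b) - b) \<longlongrightarrow> 0) F" for b
    using tendsto_diff[OF L.tendsto[OF J] tendsto_const[of b], of b] by (simp add: L_J0)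
  then have \<delta>0: "(\<delta> \<longlongrightarrow> 0) F"
    unfolding \<delta>_def by (intro tendsto_null_sum tendsto_norm_zero)
  have est: "norm (L (J t v) - v) \<le> \<delta> t * norm v" if "linear (J t)" for t v
  proof -
    interpret J: linear "J t" by fact
    have "L (J t v) - v = (\<Sum>b\<in>Basis. (v \<bullet> b) *\<^sub>R (L (J t b) - b))"
      by (subst (1 2) euclidean_representation[of v, symmetric])
        (simp only: J.sum J.scaleR L.sum L.scaleR scaleR_diff_right sum_subtractf)
    also have "norm \<dots> \<le> (\<Sum>b\<in>Basis. norm (L (J t b) - b) * norm v)"
      by (rule sum_norm_le) (metis Basis_le_norm mult.commute mult_left_mono norm_ge_zero norm_scaleR)
    finally show ?thesis by (simp add: \<delta>_def sum_distrib_right)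
  qed
  define y where "y t = L (J t (z t))" for t
  have y: "(y \<longlongrightarrow> L w) F" unfolding y_def by (rule L.tendsto[OF w])
  \<comment> \<open>Nothing is known about the size of \<open>z\<close>. Once
    \<open>\<delta> t < 1/2\<close>, half of \<open>norm (z t)\<close> is absorbed, and
    \<open>norm (z t)\<close> is at most twice the norm of the convergent
    \<open>y t\<close>.\<close>
  have "eventually (\<lambda>t. \<delta> t < 1/2) F" by (rule order_tendstoD[OF \<delta>0]) simp
  then have "eventually (\<lambda>t. norm (z t - y t) \<le> \<delta> t * (2 * norm (y t))) F"
    using lin
  proof eventually_elim
    case (elim t)
    have e: "norm (z t - y t) \<le> \<delta> t * norm (z t)"
      using est[OF elim(2), of "z t"] by (simp add: y_def norm_minus_commute)
    have "\<delta> t \<ge> 0" unfolding \<delta>_def by (simp add: sum_nonneg)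
    have "\<delta> t * norm (z t) \<le> 1/2 * norm (z t)"
      using elim(1) by (intro mult_right_mono) auto
    with e have "norm (z t) \<le> 2 * norm (y t)"
      using norm_triangle_sub[of "z t" "y t"] by linarith
    with \<open>\<delta> t \<ge> 0\<close> have "\<delta> t * norm (z t) \<le> \<delta> t * (2 * norm (y t))"
      by (intro mult_left_mono)
    with e show ?case by linarith
  qed
  moreover have "((\<lambda>t. \<delta> t * (2 * norm (y t))) \<longlongrightarrow> 0) F"
    using tendsto_mult[OF \<delta>0 tendsto_mult[OF tendsto_const tendsto_norm[OF y]]] by simp
  ultimately have "((\<lambda>t. z t - y t) \<longlongrightarrow> 0) F"
    by (rule Lim_null_comparison)
  then have z: "(z \<longlongrightarrow> L w) F" using Lim_transform[OF y] by blast
  \<comment> \<open>Now that \<open>z\<close> converges to \<open>L w\<close>, the limit of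
    \<open>J t (z t)\<close> follows from a basis expansion, since \<open>J t\<close> converges on
    each basis vector. Uniqueness of limits then identifies \<open>w\<close>.\<close>
  have "((\<lambda>t. \<Sum>b\<in>Basis. (z t \<bullet> b) *\<^sub>R J t b) \<longlongrightarrow> (\<Sum>b\<in>Basis. (L w \<bullet> b) *\<^sub>R J0 b)) F"
    by (intro tendsto_intros z J)
  moreover have rep: "(\<Sum>b\<in>Basis. (v \<bullet> b) *\<^sub>R K b) = K v" if "linear K" for K :: "'f \<Rightarrow> 'e" and v
  proof -
    interpret linear K by fact
    show ?thesis by (subst (2) euclidean_representation[of v, symmetric]) (simp only: sum scaleR)
  qed
  ultimately have "((\<lambda>t. J t (z t)) \<longlongrightarrow> J0 (L w)) F"
    using assms(3) by (auto intro: Lim_transform_eventually eventually_mono[OF lin])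
  then have "w = J0 (L w)" using w F tendsto_unique by blast
  then show ?thesis by blast
qed

section \<open>Charts and tangent vectors\<close>

lemma frechet_derivative_eqI: "(f has_derivative f') (at x) \<Longrightarrow> frechet_derivative f (at x) = f'"
  using frechet_derivative_at by metis

lemma has_derivative_frechet_cong:
  assumes "(f has_derivative f') (at x)" "open S" "x \<in> S" "\<And>y. y \<in> S \<Longrightarrow> f y = g y"
  shows "g differentiable at x" "frechet_derivative g (at x) = f'"
  using has_derivative_transform_within_open[OF assms] frechet_derivative_eqI differentiableI
  by blast+

lemma chart_inv_chart:
  assumes "smooth_atlas A" "c \<in> A" "p \<in> fst c"
  shows "chart_inv c (snd c p) = p"
  using assms unfolding smooth_atlas_def homeomorphism_def by blast

text \<open>Inside the open image of the chart, this set is the preimage of \<open>U\<close> under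
  the continuous inverse of the chart.\<close>

lemma open_chart_image:
  assumes "smooth_atlas A" "c \<in> A" "open U"
  shows "open (snd c ` (fst c \<inter> U))"
proof -
  have h: "homeomorphism (fst c) (snd c ` fst c) (snd c) (chart_inv c)"
    and o: "open (snd c ` fst c)"
    using assms unfolding smooth_atlas_def by blast+
  have "snd c ` (fst c \<inter> U) = snd c ` fst c \<inter> chart_inv c -` U"
    using chart_inv_chart[OF assms(1,2)] by auto
  then show ?thesis
    using h o assms(3) by (simp add: homeomorphism_def continuous_on_open_vimage open_Int
        continuous_open_preimage)
qed

lemma open_chart_domain: "smooth_atlas A \<Longrightarrow> c \<in> A \<Longrightarrow> open (fst c)"
  unfolding smooth_atlas_def by blast

lemma chart_at_atlas:
  assumes "smooth_atlas A"
  shows "chart_at A p \<in> A" "p \<in> fst (chart_at A p)"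
proof -
  have "\<exists>c. c \<in> A \<and> p \<in> fst c" using assms unfolding smooth_atlas_def by blast
  from someI_ex[OF this] show "chart_at A p \<in> A" "p \<in> fst (chart_at A p)"
    unfolding chart_at_def by blast+
qed

lemma smooth_on_transition:
  assumes "smooth_atlas A" "c \<in> A" "c' \<in> A"
  shows "smooth_on (snd c' \<circ> chart_inv c) (snd c ` (fst c \<inter> fst c'))"
  using assms unfolding smooth_atlas_def by blast

lemma transition_has_derivative:
  assumes "smooth_atlas A" "c \<in> A" "c' \<in> A" "p \<in> fst c" "p \<in> fst c'"
  shows "((snd c' \<circ> chart_inv c) has_derivative
      frechet_derivative (snd c' \<circ> chart_inv c) (at (snd c p))) (at (snd c p))"
  using smooth_on_has_derivative[OF smooth_on_transition[OF assms(1-3)]] assms(4,5) by blast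

text \<open>Near the point, \<open>f\<close> read in \<open>c\<close> is \<open>f\<close> read in
  \<open>c'\<close> after the transition map, so this is the chain rule. The equality holds only on
  the image of the overlap, which is open.\<close>

lemma chart_change_derivative:
  assumes A: "smooth_atlas A" "c \<in> A" "c' \<in> A" "p \<in> fst c" "p \<in> fst c'"
    and f: "(f \<circ> chart_inv c') differentiable at (snd c' p)"
  shows "(f \<circ> chart_inv c) differentiable at (snd c p)"
    and "frechet_derivative (f \<circ> chart_inv c) (at (snd c p)) v =
      frechet_derivative (f \<circ> chart_inv c') (at (snd c' p))
        (frechet_derivative (snd c' \<circ> chart_inv c) (at (snd c p)) v)"
proof -
  let ?S = "snd c ` (fst c \<inter> fst c')"
  note inv = chart_inv_chart[OF A(1)]
  have "((f \<circ> chart_inv c') has_derivative frechet_derivative (f \<circ> chart_inv c') (at (snd c' p)))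
      (at ((snd c' \<circ> chart_inv c) (snd c p)))"
    using f inv A by (simp add: frechet_derivative_works)
  from diff_chain_at[OF transition_has_derivative[OF A] this]
  have D: "((f \<circ> chart_inv c') \<circ> (snd c' \<circ> chart_inv c) has_derivative
      frechet_derivative (f \<circ> chart_inv c') (at (snd c' p)) \<circ>
      frechet_derivative (snd c' \<circ> chart_inv c) (at (snd c p))) (at (snd c p))" .
  have S: "open ?S" "snd c p \<in> ?S"
    using open_chart_image[OF A(1,2) open_chart_domain[OF A(1,3)]] A by auto
  have eq: "((f \<circ> chart_inv c') \<circ> (snd c' \<circ> chart_inv c)) y = (f \<circ> chart_inv c) y" if "y \<in> ?S" for y
    using that inv A by auto
  note * = has_derivative_frechet_cong[where g="f \<circ> chart_inv c", OF D S eq]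
  show "(f \<circ> chart_inv c) differentiable at (snd c p)" using *(1) .
  show "frechet_derivative (f \<circ> chart_inv c) (at (snd c p)) v =
      frechet_derivative (f \<circ> chart_inv c') (at (snd c' p))
        (frechet_derivative (snd c' \<circ> chart_inv c) (at (snd c p)) v)"
    using *(2) by simp
qed

text \<open>\<open>dir_deriv\<close> uses the arbitrary chart \<open>chart_at A p\<close>. The
  transformation law of \<open>x\<close> matches the chain rule, so every chart around
  \<open>p\<close> gives the same value.\<close>

lemma dir_deriv_chart:
  assumes A: "smooth_atlas A" "c \<in> A" "p \<in> fst c" and x: "x \<in> tangent_space A p"
    and f: "(f \<circ> chart_inv c) differentiable at (snd c p)"
  shows "dir_deriv A p x f = frechet_derivative (f \<circ> chart_inv c) (at (snd c p)) (x c)"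
proof -
  note c' = chart_at_atlas[OF A(1), of p]
  have "x c = frechet_derivative (snd c \<circ> chart_inv (chart_at A p)) (at (snd (chart_at A p) p))
      (x (chart_at A p))"
    using x c' A unfolding tangent_space_def by blast
  then show ?thesis
    using chart_change_derivative(2)[OF A(1) c'(1) A(2) c'(2) A(3) f, of "x (chart_at A p)"]
    by (simp only: dir_deriv_def Let_def)
qed

lemma tangent_space_transition:
  "v \<in> tangent_space A p \<Longrightarrow> c \<in> A \<Longrightarrow> c' \<in> A \<Longrightarrow> p \<in> fst c \<Longrightarrow> p \<in> fst c' \<Longrightarrow>
    v c' = frechet_derivative (snd c' \<circ> chart_inv c) (at (snd c p)) (v c)"
  unfolding tangent_space_def by blast

lemma linear_transition:
  assumes "smooth_atlas A" "c \<in> A" "c' \<in> A" "p \<in> fst c" "p \<in> fst c'"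
  shows "linear (frechet_derivative (snd c' \<circ> chart_inv c) (at (snd c p)))"
  using transition_has_derivative[OF assms] has_derivative_linear by blast

lemma tangent_spaceI:
  assumes "\<And>c. \<not> (c \<in> A \<and> p \<in> fst c) \<Longrightarrow> v c = 0"
    and "\<And>c c'. c \<in> A \<Longrightarrow> c' \<in> A \<Longrightarrow> p \<in> fst c \<Longrightarrow> p \<in> fst c' \<Longrightarrow>
      v c' = frechet_derivative (snd c' \<circ> chart_inv c) (at (snd c p)) (v c)"
  shows "v \<in> tangent_space A p"
  using assms unfolding tangent_space_def by blast

lemma tangent_space_zero_outside:
  "v \<in> tangent_space A p \<Longrightarrow> \<not> (c \<in> A \<and> p \<in> fst c) \<Longrightarrow> v c = 0"
  unfolding tangent_space_def by blast

lemma subspace_tangent_space: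
  assumes "smooth_atlas A"
  shows "subspace (tangent_space A p)"
proof (rule subspaceI)
  show "0 \<in> tangent_space A p"
    by (rule tangent_spaceI) (simp_all add: linear_0[OF linear_transition[OF assms]])
next
  fix v w assume v: "v \<in> tangent_space A p" and w: "w \<in> tangent_space A p"
  show "v + w \<in> tangent_space A p"
  proof (rule tangent_spaceI)
    fix c c' assume c: "c \<in> A" "c' \<in> A" "p \<in> fst c" "p \<in> fst c'"
    show "(v + w) c' = frechet_derivative (snd c' \<circ> chart_inv c) (at (snd c p)) ((v + w) c)"
      using tangent_space_transition[OF v c] tangent_space_transition[OF w c]
        linear_add[OF linear_transition[OF assms c]] by simp
  qed (use v w in \<open>simp add: tangent_space_zero_outside\<close>)
next
  fix r :: real and v assume v: "v \<in> tangent_space A p"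
  show "r *\<^sub>R v \<in> tangent_space A p"
  proof (rule tangent_spaceI)
    fix c c' assume c: "c \<in> A" "c' \<in> A" "p \<in> fst c" "p \<in> fst c'"
    show "(r *\<^sub>R v) c' = frechet_derivative (snd c' \<circ> chart_inv c) (at (snd c p)) ((r *\<^sub>R v) c)"
      using tangent_space_transition[OF v c] linear_cmul[OF linear_transition[OF assms c]]
      by (simp add: scaleR_fun_def)
  qed (use v in \<open>simp add: tangent_space_zero_outside scaleR_fun_def\<close>)
qed

text \<open>The transition map from a chart to itself is the identity on an open set around the
  point.\<close>

lemma coord_vec_self:
  assumes A: "smooth_atlas A" "c \<in> A" "p \<in> fst c"
  shows "coord_vec A c p u c = u"
proof -
  have S: "open (snd c ` (fst c \<inter> UNIV))" "snd c p \<in> snd c ` (fst c \<inter> UNIV)"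
    using open_chart_image[OF A(1,2) open_UNIV] A(3) by auto
  have "frechet_derivative (snd c \<circ> chart_inv c) (at (snd c p)) = (\<lambda>v. v)"
    by (rule has_derivative_frechet_cong(2)[OF has_derivative_ident S])
      (use chart_inv_chart[OF A(1,2)] in auto)
  then show ?thesis using A by (simp add: coord_vec_def)
qed

text \<open>The compatibility of the components is the cocycle rule for derivatives of transition
  maps, that is, \<open>chart_change_derivative\<close> with a chart as the function.\<close>

lemma coord_vec_tangent:
  assumes A: "smooth_atlas A" "c \<in> A" "p \<in> fst c"
  shows "coord_vec A c p u \<in> tangent_space A p"
proof (rule tangent_spaceI)
  fix c1 c2 assume c: "c1 \<in> A" "c2 \<in> A" "p \<in> fst c1" "p \<in> fst c2"
  show "coord_vec A c p u c2 =
      frechet_derivative (snd c2 \<circ> chart_inv c1) (at (snd c1 p)) (coord_vec A c p u c1)"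
    using chart_change_derivative(2)[OF A(1,2) c(1) A(3) c(3)
        differentiableI[OF transition_has_derivative[OF A(1) c]]] c
    by (simp only: coord_vec_def) simp
qed (simp only: coord_vec_def if_False)

lemma linear_coord_vec:
  assumes A: "smooth_atlas A" "c \<in> A" "p \<in> fst c"
  shows "linear (coord_vec A c p)"
proof (rule linearI; rule ext)
  note lin = linear_transition[OF A(1,2) _ A(3)]
  show "coord_vec A c p (u + v) c' = (coord_vec A c p u + coord_vec A c p v) c'" for u v c'
    using linear_add[OF lin[of c']] by (simp add: coord_vec_def)
  show "coord_vec A c p (r *\<^sub>R v) c' = (r *\<^sub>R coord_vec A c p v) c'" for r v c'
    using linear_cmul[OF lin[of c']] by (simp add: coord_vec_def scaleR_fun_def)
qed

text \<open>One component determines a tangent vector: the transformation law gives its values at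
  the other charts around \<open>p\<close>, and elsewhere both sides are normalised to 0.\<close>

lemma tangent_eq_coord_vec:
  assumes "v \<in> tangent_space A p" "c \<in> A" "p \<in> fst c"
  shows "v = coord_vec A c p (v c)"
proof
  show "v c' = coord_vec A c p (v c) c'" for c'
    using tangent_space_transition[OF assms(1,2) _ assms(3), of c']
      tangent_space_zero_outside[OF assms(1), of c'] by (simp only: coord_vec_def) simp
qed

lemma tangent_eqI:
  assumes "v \<in> tangent_space A p" "w \<in> tangent_space A p" "c \<in> A" "p \<in> fst c" "v c = w c"
  shows "v = w"
  using tangent_eq_coord_vec assms by metis

section \<open>Smooth vector fields\<close>

text \<open>Read in \<open>c'\<close>, the component is a derivative of the transition map out of
  \<open>c\<close>, taken at the image of the point in \<open>c\<close>. Its smoothness therefore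
  needs a composition with the reverse transition.\<close>

lemma vector_field_on_coord_vec:
  assumes A: "smooth_atlas A" "c \<in> A"
  shows "vector_field_on A (fst c) (\<lambda>q. coord_vec A c q u)"
  unfolding vector_field_on_def
proof (intro conjI ballI)
  show "open (fst c)" by (rule open_chart_domain[OF A])
  show "coord_vec A c p u \<in> tangent_space A p" if "p \<in> fst c" for p
    by (rule coord_vec_tangent[OF A that])
  fix c' assume c': "c' \<in> A"
  let ?S = "snd c' ` (fst c' \<inter> fst c)" and ?T = "snd c ` (fst c \<inter> fst c')"
  have o: "open ?S" "open ?T"
    using open_chart_image open_chart_domain A c' by blast+
  have sub: "(snd c \<circ> chart_inv c') ` ?S \<subseteq> ?T" using chart_inv_chart[OF A(1) c'] by auto
  have "smooth_on (\<lambda>y. frechet_derivative (snd c' \<circ> chart_inv c)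
      (at ((snd c \<circ> chart_inv c') y)) u) ?S"
    by (rule smooth_on_compose[OF o sub smooth_on_frechet_derivative])
      (rule smooth_on_transition[OF A(1)]; fact A c')+
  then show "smooth_on (\<lambda>y. coord_vec A c (chart_inv c' y) u c') ?S"
    by (rule smooth_on_cong[OF _ o(1)]) (auto simp: coord_vec_def chart_inv_chart[OF A(1) c'] c')
qed

lemma vector_field_on_subset:
  assumes "vector_field_on A U X" "open V" "V \<subseteq> U"
  shows "vector_field_on A V X"
  unfolding vector_field_on_def
proof (intro conjI ballI)
  show "smooth_on (\<lambda>u. X (chart_inv c u) c) (snd c ` (fst c \<inter> V))" if "c \<in> A" for c
    by (rule smooth_on_subset[of _ "snd c ` (fst c \<inter> U)"])
      (use assms that in \<open>auto simp only: vector_field_on_def\<close>)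
qed (use assms in \<open>auto simp: vector_field_on_def\<close>)

text \<open>\<open>vector_field_on\<close> gives smoothness of the component of a chart read in that
  same chart; composing with a transition map gives it in every chart, as \<open>smooth_fun\<close>
  requires.\<close>

lemma vector_field_on_component:
  assumes A: "smooth_atlas A" "c \<in> A" and X: "vector_field_on A U X"
  shows "smooth_fun A (fst c \<inter> U) (\<lambda>q. X q c \<bullet> b)"
  unfolding smooth_fun_def
proof (intro conjI ballI)
  have oU: "open U" using X unfolding vector_field_on_def by blast
  show "open (fst c \<inter> U)" using open_chart_domain[OF A] oU by blast
  fix c' assume c': "c' \<in> A"
  let ?S = "snd c' ` (fst c' \<inter> (fst c \<inter> U))" and ?T = "snd c ` (fst c \<inter> U)"
  have o: "open ?S" "open ?T"
    using open_chart_image open_chart_domain A c' oU by blast+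
  have sub: "(snd c \<circ> chart_inv c') ` ?S \<subseteq> ?T" using chart_inv_chart[OF A(1) c'] by auto
  have "smooth_on (snd c \<circ> chart_inv c') ?S"
    by (rule smooth_on_subset[OF smooth_on_transition[OF A(1) c' A(2)]]) blast
  moreover have "smooth_on (\<lambda>y. X (chart_inv c y) c) ?T"
    using X A unfolding vector_field_on_def by blast
  ultimately have "smooth_on (\<lambda>y. X (chart_inv c ((snd c \<circ> chart_inv c') y)) c) ?S"
    using smooth_on_compose[OF o sub] by blast
  then have "smooth_on (\<lambda>y. X (chart_inv c' y) c) ?S"
    by (rule smooth_on_cong[OF _ o(1)]) (auto simp: chart_inv_chart[OF A(1)] c' A)
  then show "smooth_on ((\<lambda>q. X q c \<bullet> b) \<circ> chart_inv c') ?S"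
    unfolding smooth_on_def comp_def
    by (intro allI Ck_on_bilinear[OF bounded_bilinear_inner o(1)] Ck_on_const) blast
qed

lemma vector_field_on_sum:
  assumes A: "smooth_atlas A" and "open U" and "\<And>i. i \<in> I \<Longrightarrow> vector_field_on A U (X i)"
  shows "vector_field_on A U (\<lambda>q. \<Sum>i\<in>I. X i q)"
  unfolding vector_field_on_def
proof (intro conjI ballI)
  show "(\<Sum>i\<in>I. X i p) \<in> tangent_space A p" if "p \<in> U" for p
    using assms that unfolding vector_field_on_def
    by (intro subspace_sum[OF subspace_tangent_space]) auto
  fix c assume c: "c \<in> A"
  have *: "(\<Sum>i\<in>I. X i q) c = (\<Sum>i\<in>I. X i q c)" for q
    by (induction I rule: infinite_finite_induct) auto
  show "smooth_on (\<lambda>u. (\<Sum>i\<in>I. X i (chart_inv c u)) c) (snd c ` (fst c \<inter> U))"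
    using assms c unfolding vector_field_on_def smooth_on_def *
    by (auto intro!: Ck_on_sum open_chart_image)
qed fact

lemma vector_field_on_scaleR:
  assumes A: "smooth_atlas A" and f: "smooth_fun A U f" and X: "vector_field_on A U X"
  shows "vector_field_on A U (\<lambda>q. f q *\<^sub>R X q)"
  unfolding vector_field_on_def
proof (intro conjI ballI)
  show oU: "open U" using f unfolding smooth_fun_def by blast
  show "f p *\<^sub>R X p \<in> tangent_space A p" if "p \<in> U" for p
    using X that unfolding vector_field_on_def
    by (intro subspace_scale[OF subspace_tangent_space[OF A]]) auto
  fix c assume c: "c \<in> A"
  show "smooth_on (\<lambda>u. (f (chart_inv c u) *\<^sub>R X (chart_inv c u)) c) (snd c ` (fst c \<inter> U))"
    using f X c unfolding vector_field_on_def smooth_fun_def smooth_on_def scaleR_fun_def comp_def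
    by (auto intro!: Ck_on_bilinear[OF bounded_bilinear_scaleR] open_chart_image[OF A c oU])
qed

section \<open>Differentials and tangent spaces of submanifolds\<close>

lemma open_smooth_map_chart_domain:
  assumes "smooth_atlas B" "smooth_atlas A" "smooth_map B A \<iota>" "b \<in> B" "c \<in> A"
  shows "open (snd b ` (fst b \<inter> \<iota> -` fst c))"
proof (rule open_chart_image[OF assms(1,4)])
  have "continuous_on UNIV \<iota>" using assms(3) unfolding smooth_map_def by blast
  then show "open (\<iota> -` fst c)" using open_chart_domain[OF assms(2,5)] open_vimage by blast
qed

lemma smooth_on_smooth_map_chart:
  assumes "smooth_map B A \<iota>" "b \<in> B" "c \<in> A"
  shows "smooth_on (snd c \<circ> \<iota> \<circ> chart_inv b) (snd b ` (fst b \<inter> \<iota> -` fst c))"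
  using assms unfolding smooth_map_def by blast

lemma smooth_map_chart_has_derivative:
  assumes "smooth_map B A \<iota>" "b \<in> B" "c \<in> A" "p \<in> fst b" "\<iota> p \<in> fst c"
  shows "((snd c \<circ> \<iota> \<circ> chart_inv b) has_derivative
      frechet_derivative (snd c \<circ> \<iota> \<circ> chart_inv b) (at (snd b p))) (at (snd b p))"
  using smooth_on_has_derivative[OF smooth_on_smooth_map_chart[OF assms(1-3)]] assms(4,5) by blast

text \<open>The counterpart of \<open>chart_change_derivative\<close>, with the chart expression of
  \<iota> in place of the transition map.\<close>

lemma smooth_map_chain_rule:
  assumes B: "smooth_atlas B" and A: "smooth_atlas A" and \<iota>: "smooth_map B A \<iota>"
    and bc: "b \<in> B" "c \<in> A" "p \<in> fst b" "\<iota> p \<in> fst c"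
    and f: "(f \<circ> chart_inv c) differentiable at (snd c (\<iota> p))"
  shows "((f \<circ> \<iota>) \<circ> chart_inv b) differentiable at (snd b p)"
    and "frechet_derivative ((f \<circ> \<iota>) \<circ> chart_inv b) (at (snd b p)) v =
      frechet_derivative (f \<circ> chart_inv c) (at (snd c (\<iota> p)))
        (frechet_derivative (snd c \<circ> \<iota> \<circ> chart_inv b) (at (snd b p)) v)"
proof -
  let ?S = "snd b ` (fst b \<inter> \<iota> -` fst c)"
  have "((f \<circ> chart_inv c) has_derivative frechet_derivative (f \<circ> chart_inv c) (at (snd c (\<iota> p))))
      (at ((snd c \<circ> \<iota> \<circ> chart_inv b) (snd b p)))"
    using f chart_inv_chart[OF B bc(1,3)] by (simp add: frechet_derivative_works)
  note D = diff_chain_at[OF smooth_map_chart_has_derivative[OF \<iota> bc] this]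
  have S: "open ?S" "snd b p \<in> ?S"
    using open_smooth_map_chart_domain[OF B A \<iota> bc(1,2)] bc by auto
  have eq: "((f \<circ> chart_inv c) \<circ> (snd c \<circ> \<iota> \<circ> chart_inv b)) y = ((f \<circ> \<iota>) \<circ> chart_inv b) y"
    if "y \<in> ?S" for y
    using that chart_inv_chart[OF A bc(2)] chart_inv_chart[OF B bc(1)] by auto
  note * = has_derivative_frechet_cong[where g="(f \<circ> \<iota>) \<circ> chart_inv b", OF D S eq]
  show "((f \<circ> \<iota>) \<circ> chart_inv b) differentiable at (snd b p)" using *(1) .
  show "frechet_derivative ((f \<circ> \<iota>) \<circ> chart_inv b) (at (snd b p)) v =
      frechet_derivative (f \<circ> chart_inv c) (at (snd c (\<iota> p)))
        (frechet_derivative (snd c \<circ> \<iota> \<circ> chart_inv b) (at (snd b p)) v)"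
    using *(2) by simp
qed

lemma differential_chart:
  assumes B: "smooth_atlas B" and \<iota>: "smooth_map B A \<iota>"
    and bc: "b \<in> B" "c \<in> A" "p \<in> fst b" "\<iota> p \<in> fst c" and x: "x \<in> tangent_space B p"
  shows "differential B A \<iota> p x c = frechet_derivative (snd c \<circ> \<iota> \<circ> chart_inv b) (at (snd b p)) (x b)"
  using dir_deriv_chart[OF B bc(1,3) x differentiableI[OF smooth_map_chart_has_derivative[OF \<iota> bc]]] bc
  by (simp add: differential_def)

lemma differential_tangent:
  assumes B: "smooth_atlas B" and A: "smooth_atlas A" and \<iota>: "smooth_map B A \<iota>"
    and x: "x \<in> tangent_space B p"
  shows "differential B A \<iota> p x \<in> tangent_space A (\<iota> p)"
proof (rule tangent_spaceI)
  note b = chart_at_atlas[OF B, of p]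
  fix c c' assume c: "c \<in> A" "c' \<in> A" "\<iota> p \<in> fst c" "\<iota> p \<in> fst c'"
  show "differential B A \<iota> p x c' =
      frechet_derivative (snd c' \<circ> chart_inv c) (at (snd c (\<iota> p))) (differential B A \<iota> p x c)"
    unfolding differential_chart[OF B \<iota> b(1) c(1) b(2) c(3) x]
      differential_chart[OF B \<iota> b(1) c(2) b(2) c(4) x]
    by (rule smooth_map_chain_rule(2)[OF B A \<iota> b(1) c(1) b(2) c(3)
          differentiableI[OF transition_has_derivative[OF A c]]])
qed (simp only: differential_def if_False)

text \<open>Links derivatives taken on the submanifold, as in \<open>cov_deriv_along\<close>, with
  ambient derivatives, as in the Leibniz rule for \<open>nab\<close>.\<close>

lemma dir_deriv_comp_smooth_map:
  assumes B: "smooth_atlas B" and A: "smooth_atlas A" and \<iota>: "smooth_map B A \<iota>"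
    and x: "x \<in> tangent_space B p" and c: "c \<in> A" "\<iota> p \<in> fst c"
    and f: "(f \<circ> chart_inv c) differentiable at (snd c (\<iota> p))"
  shows "dir_deriv B p x (\<lambda>q. f (\<iota> q)) = dir_deriv A (\<iota> p) (differential B A \<iota> p x) f"
proof -
  note b = chart_at_atlas[OF B, of p]
  note chain = smooth_map_chain_rule[OF B A \<iota> b(1) c(1) b(2) c(2) f]
  have "dir_deriv B p x (f \<circ> \<iota>) = dir_deriv A (\<iota> p) (differential B A \<iota> p x) f"
    unfolding dir_deriv_chart[OF B b x chain(1)]
      dir_deriv_chart[OF A c differential_tangent[OF B A \<iota> x] f]
      differential_chart[OF B \<iota> b(1) c(1) b(2) c(2) x]
    by (rule chain(2))
  then show ?thesis by (simp add: comp_def)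
qed

lemma differential_coord_vec:
  assumes B: "smooth_atlas B" and A: "smooth_atlas A" and \<iota>: "smooth_map B A \<iota>"
    and bc: "b \<in> B" "c \<in> A" "p \<in> fst b" "\<iota> p \<in> fst c"
  shows "differential B A \<iota> p (coord_vec B b p u) =
    coord_vec A c (\<iota> p) (frechet_derivative (snd c \<circ> \<iota> \<circ> chart_inv b) (at (snd b p)) u)"
proof -
  note t = coord_vec_tangent[OF B bc(1,3)]
  show ?thesis
    by (rule tangent_eqI[OF differential_tangent[OF B A \<iota> t] coord_vec_tangent[OF A bc(2,4)] bc(2,4)])
      (simp only: differential_chart[OF B \<iota> bc t] coord_vec_self[OF B bc(1,3)]
        coord_vec_self[OF A bc(2,4)])
qed

text \<open>Parametrises the tangent space of the submanifold by the Euclidean model space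
  \<open>'f\<close>, which makes finite-dimensional linear algebra applicable to it.\<close>

lemma sub_tangent_eq_range:
  assumes B: "smooth_atlas B" and A: "smooth_atlas A" and \<iota>: "smooth_map B A \<iota>"
    and bc: "b \<in> B" "c \<in> A" "p \<in> fst b" "\<iota> p \<in> fst c"
  shows "sub_tangent B A \<iota> p = range (\<lambda>u. coord_vec A c (\<iota> p)
    (frechet_derivative (snd c \<circ> \<iota> \<circ> chart_inv b) (at (snd b p)) u))"
proof -
  have "tangent_space B p = range (coord_vec B b p)"
    using tangent_eq_coord_vec[OF _ bc(1,3)] coord_vec_tangent[OF B bc(1,3)] by blast
  then show ?thesis
    by (simp add: sub_tangent_def image_image differential_coord_vec[OF B A \<iota> bc])
qed

text \<open>\<open>immersion\<close> asks for injectivity on abstract tangent vectors;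
  \<open>coord_vec\<close> translates this into injectivity of the derivative in charts.\<close>

lemma inj_frechet_derivative_immersion:
  assumes B: "smooth_atlas B" and A: "smooth_atlas A" and \<iota>: "immersion B A \<iota>"
    and bc: "b \<in> B" "c \<in> A" "p \<in> fst b" "\<iota> p \<in> fst c"
  shows "inj (frechet_derivative (snd c \<circ> \<iota> \<circ> chart_inv b) (at (snd b p)))"
proof (rule injI)
  have sm: "smooth_map B A \<iota>" and inj: "inj_on (differential B A \<iota> p) (tangent_space B p)"
    using \<iota> unfolding immersion_def by blast+
  fix u v assume "frechet_derivative (snd c \<circ> \<iota> \<circ> chart_inv b) (at (snd b p)) u =
    frechet_derivative (snd c \<circ> \<iota> \<circ> chart_inv b) (at (snd b p)) v"
  then have "differential B A \<iota> p (coord_vec B b p u) = differential B A \<iota> p (coord_vec B b p v)"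
    by (simp only: differential_coord_vec[OF B A sm bc])
  then have "coord_vec B b p u = coord_vec B b p v"
    by (rule inj_onD[OF inj]) (rule coord_vec_tangent[OF B bc(1,3)])+
  then show "u = v" using coord_vec_self[OF B bc(1,3)] by metis
qed

lemma linear_sub_tangent_param:
  assumes B: "smooth_atlas B" and A: "smooth_atlas A" and \<iota>: "smooth_map B A \<iota>"
    and bc: "b \<in> B" "c \<in> A" "p \<in> fst b" "\<iota> p \<in> fst c"
  shows "linear (\<lambda>u. coord_vec A c (\<iota> p)
    (frechet_derivative (snd c \<circ> \<iota> \<circ> chart_inv b) (at (snd b p)) u))"
  using linear_compose[OF has_derivative_linear[OF smooth_map_chart_has_derivative[OF \<iota> bc]]
      linear_coord_vec[OF A bc(2,4)]]
  by (simp add: comp_def)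

lemma subspace_sub_tangent:
  assumes B: "smooth_atlas B" and A: "smooth_atlas A" and \<iota>: "smooth_map B A \<iota>"
  shows "subspace (sub_tangent B A \<iota> p)"
  unfolding sub_tangent_eq_range[OF assms chart_at_atlas(1)[OF B] chart_at_atlas(1)[OF A]
      chart_at_atlas(2)[OF B] chart_at_atlas(2)[OF A]]
  by (rule linear_subspace_image[OF linear_sub_tangent_param[OF assms chart_at_atlas(1)[OF B]
          chart_at_atlas(1)[OF A] chart_at_atlas(2)[OF B] chart_at_atlas(2)[OF A]] subspace_UNIV])

lemma sub_tangent_subset:
  assumes "smooth_atlas B" "smooth_atlas A" "smooth_map B A \<iota>"
  shows "sub_tangent B A \<iota> p \<subseteq> tangent_space A (\<iota> p)"
  unfolding sub_tangent_def using differential_tangent[OF assms] by blast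

section \<open>Orthogonal decomposition along a non-degenerate submanifold\<close>

text \<open>Orthogonality of \<open>v - D u\<close> to \<open>range D\<close> is a linear system for
  \<open>u\<close> in \<open>'f\<close>. Its matrix is the Gram matrix of the pulled-back form,
  which is invertible by non-degeneracy.\<close>

lemma nondegenerate_orthogonal_decomposition:
  fixes D :: "'f::euclidean_space \<Rightarrow> 'v::real_vector" and \<beta> :: "'v \<Rightarrow> 'v \<Rightarrow> real"
  assumes D: "linear D" "inj D" "range D \<subseteq> W" and W: "subspace W" "v \<in> W"
    and sym: "\<And>u w. u \<in> W \<Longrightarrow> w \<in> W \<Longrightarrow> \<beta> u w = \<beta> w u"
    and add: "\<And>u v w. u \<in> W \<Longrightarrow> v \<in> W \<Longrightarrow> w \<in> W \<Longrightarrow> \<beta> (u + v) w = \<beta> u w + \<beta> v w"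
    and scale: "\<And>r u w. u \<in> W \<Longrightarrow> w \<in> W \<Longrightarrow> \<beta> (r *\<^sub>R u) w = r * \<beta> u w"
    and nondeg: "nondegenerate_on \<beta> (range D)"
  shows "\<exists>t\<in>range D. \<forall>w\<in>range D. \<beta> (v - t) w = 0"
proof -
  interpret D: linear D by fact
  have DW: "D u \<in> W" for u using D(3) by blast
  have lin: "linear (\<lambda>u. \<beta> w (D u))" if "w \<in> W" for w
    using that DW by (intro linearI) (simp_all add: D.add D.scaleR sym[of w] add scale W
        subspace_add subspace_scale)
  have expand: "\<beta> w (D u) = (\<Sum>b\<in>Basis. (u \<bullet> b) * \<beta> w (D b))" if "w \<in> W" for w u
    using linear_sum[OF lin[OF that], of "\<lambda>b. (u \<bullet> b) *\<^sub>R b" Basis] linear_cmul[OF lin[OF that]]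
    by (simp add: euclidean_representation)
  \<comment> \<open>The Gram operator of the pulled-back form: its component along \<open>b\<close>
    is \<open>\<beta> (D u) (D b)\<close>.\<close>
  define G where "G u = (\<Sum>b\<in>Basis. \<beta> (D u) (D b) *\<^sub>R b)" for u
  have G: "linear G"
    by (rule linearI) (simp_all add: G_def D.add D.scaleR add scale DW scaleR_add_left
        sum.distrib scaleR_sum_right)
  have G_inner: "G u \<bullet> b = \<beta> (D u) (D b)" if "b \<in> Basis" for u b
    using that unfolding G_def by simp
  have "u = 0" if "G u = 0" for u
  proof -
    have "\<beta> (D u) (D b) = 0" if "b \<in> Basis" for b using G_inner[OF that, of u] \<open>G u = 0\<close> by simp
    then have "\<beta> (D u) (D w) = 0" for w using expand[OF DW, of u w] by simp
    then have "D u = 0" using nondeg unfolding nondegenerate_on_def by blast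
    then show "u = 0" using D(2) D.zero by (metis injD)
  qed
  then have "inj G" using linear_injective_0[OF G] by blast
  then have "surj G" using linear_injective_imp_surjective[OF G] by blast
  \<comment> \<open>Injectivity gives surjectivity in finite dimension, so the Gram system with
    right-hand side \<open>\<beta> v (D b)\<close> is solvable.\<close>
  then obtain u where u: "G u = (\<Sum>b\<in>Basis. \<beta> v (D b) *\<^sub>R b)" by (metis surjD)
  have vt: "v - D u \<in> W" using W DW subspace_diff by blast
  have neg: "\<beta> (v - D u) (D w) = \<beta> v (D w) - \<beta> (D u) (D w)" for w
    using add[OF vt DW[of u] DW[of w]] by simp
  have "\<beta> (D u) (D b) = \<beta> v (D b)" if "b \<in> Basis" for b
    using G_inner[OF that, of u] that unfolding u by simp
  then have "\<beta> (v - D u) (D w) = 0" for w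
    using expand[OF vt, of w] unfolding neg by simp
  then show ?thesis by blast
qed

text \<open>\<open>normal_part\<close> is a definite description, so its value carries information
  only after unique existence is shown. Existence is the orthogonal decomposition. Uniqueness holds
  because two candidates differ by a tangent vector orthogonal to all tangent vectors.\<close>

lemma normal_part_eq_0_imp_tangent:
  assumes B: "smooth_atlas B" and A: "smooth_atlas A" and \<iota>: "immersion B A \<iota>"
    and g: "semi_riemannian_metric A g" and nd: "nondegenerate_submanifold B A g \<iota>"
    and v: "v \<in> tangent_space A (\<iota> p)" and n0: "normal_part B A g \<iota> p v = 0"
  shows "v \<in> sub_tangent B A \<iota> p"
proof -
  have sm: "smooth_map B A \<iota>" using \<iota> unfolding immersion_def by blast
  let ?b = "chart_at B p" and ?c = "chart_at A (\<iota> p)" and ?T = "sub_tangent B A \<iota> p"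
  let ?W = "tangent_space A (\<iota> p)"
  note bc = chart_at_atlas(1)[OF B, of p] chart_at_atlas(1)[OF A, of "\<iota> p"]
    chart_at_atlas(2)[OF B, of p] chart_at_atlas(2)[OF A, of "\<iota> p"]
  let ?D = "\<lambda>u. coord_vec A ?c (\<iota> p)
    (frechet_derivative (snd ?c \<circ> \<iota> \<circ> chart_inv ?b) (at (snd ?b p)) u)"
  have T: "?T = range ?D" by (rule sub_tangent_eq_range[OF B A sm bc])
  \<comment> \<open>Taking the component in \<open>?c\<close> undoes \<open>coord_vec\<close>, which
    reduces the claim to injectivity of the derivative.\<close>
  have "inj ?D"
    by (rule injI, rule injD[OF inj_frechet_derivative_immersion[OF B A \<iota> bc]])
      (metis coord_vec_self[OF A bc(2,4)])
  have TW: "?T \<subseteq> ?W" by (rule sub_tangent_subset[OF B A sm])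
  note sW = subspace_tangent_space[OF A, of "\<iota> p"]
  note sT = subspace_sub_tangent[OF B A sm, of p]
  have sym: "g (\<iota> p) u w = g (\<iota> p) w u" if "u \<in> ?W" "w \<in> ?W" for u w
    using g that unfolding semi_riemannian_metric_def by blast
  have add: "g (\<iota> p) (u + u') w = g (\<iota> p) u w + g (\<iota> p) u' w" if "u \<in> ?W" "u' \<in> ?W" "w \<in> ?W" for u u' w
    using g that unfolding semi_riemannian_metric_def by blast
  have scale: "g (\<iota> p) (r *\<^sub>R u) w = r * g (\<iota> p) u w" if "u \<in> ?W" "w \<in> ?W" for r u w
    using g that unfolding semi_riemannian_metric_def by blast
  have nd': "nondegenerate_on (g (\<iota> p)) ?T"
    using nd unfolding nondegenerate_submanifold_def by blast
  obtain t where t: "t \<in> ?T" "\<forall>w\<in>?T. g (\<iota> p) (v - t) w = 0"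
    using nondegenerate_orthogonal_decomposition[OF linear_sub_tangent_param[OF B A sm bc] \<open>inj ?D\<close>
        TW[unfolded T] sW v sym add scale nd'[unfolded T]] unfolding T by blast
  let ?P = "\<lambda>n. n \<in> ?W \<and> (\<forall>w\<in>?T. g (\<iota> p) n w = 0) \<and> v - n \<in> ?T"
  have "?P (v - t)" using t v TW subspace_diff[OF sW] by auto
  moreover have "n = m" if "?P n" "?P m" for n m
  proof -
    have nm: "n - m \<in> ?T" using subspace_diff[OF sT, of "v - m" "v - n"] that by simp
    have "g (\<iota> p) (n - m) w = 0" if "w \<in> ?T" for w
      using add[of "n - m" m w] nm \<open>?P n\<close> \<open>?P m\<close> that TW by auto
    then have "n - m = 0" using nd' nm unfolding nondegenerate_on_def by blast
    then show ?thesis by simp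
  qed
  ultimately have "\<exists>!n. ?P n" by blast
  then have "?P (THE n. ?P n)" by (rule theI')
  then have "?P 0" using n0 unfolding normal_part_def by simp
  then show ?thesis by simp
qed

section \<open>Connections\<close>

lemma dir_deriv_locally_const:
  assumes A: "smooth_atlas A" and U: "open U" "p \<in> U" and f: "\<And>q. q \<in> U \<Longrightarrow> f q = a"
  shows "dir_deriv A p x f = 0"
proof -
  let ?c = "chart_at A p"
  note c = chart_at_atlas[OF A, of p]
  have "frechet_derivative (f \<circ> chart_inv ?c) (at (snd ?c p)) = (\<lambda>v. 0)"
    by (rule has_derivative_frechet_cong(2)[OF has_derivative_const[of a]
          open_chart_image[OF A c(1) U(1)]])
      (use c U f chart_inv_chart[OF A c(1)] in auto)
  then show ?thesis by (simp add: dir_deriv_def)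
qed

text \<open>The function may be arbitrary outside \<open>U\<close>, so this covers the indicator of
  \<open>U\<close>.\<close>

lemma smooth_fun_const_on:
  assumes A: "smooth_atlas A" and U: "open U" and f: "\<And>q. q \<in> U \<Longrightarrow> f q = a"
  shows "smooth_fun A U f"
  unfolding smooth_fun_def
proof (intro conjI ballI U)
  fix c assume c: "c \<in> A"
  have "smooth_on (\<lambda>_. a) (snd c ` (fst c \<inter> U))" unfolding smooth_on_def by (simp add: Ck_on_const)
  then show "smooth_on (f \<circ> chart_inv c) (snd c ` (fst c \<inter> U))"
    by (rule smooth_on_cong[OF _ open_chart_image[OF A c U]])
      (use f chart_inv_chart[OF A c] in auto)
qed

lemma connection_add:
  assumes "affine_connection A nab" "x \<in> tangent_space A p"
    "vector_field_near A p Y" "vector_field_near A p Z"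
  shows "nab p x (\<lambda>q. Y q + Z q) = nab p x Y + nab p x Z"
proof -
  have "\<forall>p Y Z. \<forall>x\<in>tangent_space A p. vector_field_near A p Y \<longrightarrow> vector_field_near A p Z \<longrightarrow>
      nab p x (\<lambda>q. Y q + Z q) = nab p x Y + nab p x Z"
    using assms(1) unfolding affine_connection_def by (elim conjE)
  from this[rule_format, OF assms(2-4)] show ?thesis .
qed

lemma connection_leibniz:
  assumes "affine_connection A nab" "x \<in> tangent_space A p" "vector_field_near A p Y"
    "p \<in> U" "smooth_fun A U f"
  shows "nab p x (\<lambda>q. f q *\<^sub>R Y q) = dir_deriv A p x f *\<^sub>R Y p + f p *\<^sub>R nab p x Y"
proof -
  have "\<forall>p Y. \<forall>f :: _ \<Rightarrow> real. \<forall>x\<in>tangent_space A p.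
      vector_field_near A p Y \<longrightarrow> (\<exists>U. p \<in> U \<and> smooth_fun A U f) \<longrightarrow>
      nab p x (\<lambda>q. f q *\<^sub>R Y q) = dir_deriv A p x f *\<^sub>R Y p + f p *\<^sub>R nab p x Y"
    using assms(1) unfolding affine_connection_def by (elim conjE)
  moreover have "\<exists>U. p \<in> U \<and> smooth_fun A U f" using assms(4,5) by blast
  ultimately show ?thesis using assms(2,3) by simp
qed

lemma connection_tangent:
  assumes "affine_connection A nab" "x \<in> tangent_space A p" "vector_field_near A p Y"
  shows "nab p x Y \<in> tangent_space A p"
proof -
  have "\<forall>p Y. \<forall>x\<in>tangent_space A p. vector_field_near A p Y \<longrightarrow> nab p x Y \<in> tangent_space A p"
    using assms(1) unfolding affine_connection_def by (elim conjE)
  from this[rule_format, OF assms(2,3)] show ?thesis .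
qed

text \<open>The Leibniz rule for the factor 0 and the zero field, all of whose terms vanish.\<close>

lemma connection_zero:
  assumes A: "smooth_atlas A" and nab: "affine_connection A nab" and x: "x \<in> tangent_space A p"
  shows "nab p x (\<lambda>q. 0) = 0"
proof -
  have "vector_field_on A UNIV (\<lambda>q. 0)"
    using vector_field_on_sum[OF A open_UNIV, of "{}"] by simp
  then have near: "vector_field_near A p (\<lambda>q. 0)" unfolding vector_field_near_def by blast
  have sm: "smooth_fun A UNIV (\<lambda>q. 0 :: real)"
    by (rule smooth_fun_const_on[OF A open_UNIV]) (rule refl)
  show ?thesis
    using connection_leibniz[OF nab x near UNIV_I sm]
    by (simp only: scaleR_zero_left scaleR_zero_right add_0_left)
qed

text \<open>The indicator of \<open>U\<close> has value 1 and derivative 0 at \<open>p\<close>, so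
  by the Leibniz rule multiplying by it leaves the covariant derivative unchanged, while it makes
  the two fields equal everywhere.\<close>

lemma connection_local:
  assumes A: "smooth_atlas A" and nab: "affine_connection A nab" and x: "x \<in> tangent_space A p"
    and Y: "vector_field_near A p Y" and Z: "vector_field_near A p Z"
    and U: "open U" "p \<in> U" and eq: "\<And>q. q \<in> U \<Longrightarrow> Y q = Z q"
  shows "nab p x Y = nab p x Z"
proof -
  \<comment> \<open>No bump function is needed: the Leibniz rule only asks for smoothness near \<open>p\<close>.\<close>
  let ?f = "\<lambda>q. indicator U q :: real"
  have sm: "smooth_fun A U ?f" by (rule smooth_fun_const_on[OF A U(1), of _ 1]) simp
  have d: "dir_deriv A p x ?f = 0" by (rule dir_deriv_locally_const[OF A U, of _ 1]) simp
  have *: "nab p x (\<lambda>q. ?f q *\<^sub>R X q) = nab p x X" if "vector_field_near A p X" for X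
    unfolding connection_leibniz[OF nab x that U(2) sm] d using U by simp
  have fYZ: "(\<lambda>q. ?f q *\<^sub>R Y q) = (\<lambda>q. ?f q *\<^sub>R Z q)"
  proof
    show "?f q *\<^sub>R Y q = ?f q *\<^sub>R Z q" for q
      using eq by (cases "q \<in> U") simp_all
  qed
  have "nab p x Y = nab p x (\<lambda>q. ?f q *\<^sub>R Y q)" by (rule *[OF Y, symmetric])
  also have "\<dots> = nab p x Z" unfolding fYZ by (rule *[OF Z])
  finally show ?thesis .
qed

lemma connection_sum:
  assumes A: "smooth_atlas A" and nab: "affine_connection A nab" and x: "x \<in> tangent_space A p"
    and U: "p \<in> U" "open U" and I: "finite I" and f: "\<And>i. i \<in> I \<Longrightarrow> smooth_fun A U (f i)"
    and Y: "\<And>i. i \<in> I \<Longrightarrow> vector_field_on A U (Y i)"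
  shows "nab p x (\<lambda>q. \<Sum>i\<in>I. f i q *\<^sub>R Y i q) =
    (\<Sum>i\<in>I. dir_deriv A p x (f i) *\<^sub>R Y i p + f i p *\<^sub>R nab p x (Y i))"
  using I f Y
proof (induction I rule: finite_induct)
  case empty
  show ?case using connection_zero[OF A nab x] by (simp only: sum.empty)
next
  case (insert i I)
  have "vector_field_on A U (\<lambda>q. f j q *\<^sub>R Y j q)" if "j \<in> insert i I" for j
    using vector_field_on_scaleR[OF A] insert.prems that by blast
  then have near: "vector_field_near A p (\<lambda>q. f i q *\<^sub>R Y i q)"
    "vector_field_near A p (\<lambda>q. \<Sum>i\<in>I. f i q *\<^sub>R Y i q)"
    using U vector_field_on_sum[OF A U(2), of I "\<lambda>i q. f i q *\<^sub>R Y i q"]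
    unfolding vector_field_near_def by blast+
  have Yi: "vector_field_near A p (Y i)" using insert.prems U unfolding vector_field_near_def by blast
  have "nab p x (\<lambda>q. f i q *\<^sub>R Y i q) = dir_deriv A p x (f i) *\<^sub>R Y i p + f i p *\<^sub>R nab p x (Y i)"
    by (rule connection_leibniz[OF nab x Yi U(1)]) (use insert.prems in blast)
  moreover have "nab p x (\<lambda>q. \<Sum>i\<in>I. f i q *\<^sub>R Y i q) =
      (\<Sum>i\<in>I. dir_deriv A p x (f i) *\<^sub>R Y i p + f i p *\<^sub>R nab p x (Y i))"
    by (rule insert.IH) (use insert.prems in blast)+
  ultimately show ?case
    by (simp only: sum.insert[OF insert.hyps] connection_add[OF nab x near])
qed

section \<open>The covariant derivative along an immersion\<close>

lemma dir_deriv_inner: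
  assumes A: "smooth_atlas A" and c: "c \<in> A" "p \<in> fst c" and x: "x \<in> tangent_space A p"
    and f: "(f \<circ> chart_inv c) differentiable at (snd c p)"
  shows "dir_deriv A p x (\<lambda>q. f q \<bullet> b) = dir_deriv A p x f \<bullet> b"
proof -
  have D: "(((\<lambda>q. f q \<bullet> b) \<circ> chart_inv c) has_derivative
      (\<lambda>v. frechet_derivative (f \<circ> chart_inv c) (at (snd c p)) v \<bullet> b)) (at (snd c p))"
    using has_derivative_inner_left[OF f[unfolded frechet_derivative_works], of b]
    by (simp add: comp_def)
  show ?thesis
    unfolding dir_deriv_chart[OF A c x f] dir_deriv_chart[OF A c x differentiableI[OF D]]
      frechet_derivative_eqI[OF D] ..
qed

text \<open>Expanding \<open>X\<close> in coordinate fields and applying the Leibniz rule termwise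
  yields exactly the formula that defines \<open>cov_deriv_along\<close>.\<close>

lemma cov_deriv_along_restriction:
  assumes B: "smooth_atlas B" and A: "smooth_atlas A" and \<iota>: "smooth_map B A \<iota>"
    and nab: "affine_connection A nab" and X: "vector_field_near A (\<iota> p) X"
    and x: "x \<in> tangent_space B p"
  shows "cov_deriv_along B A nab \<iota> p x (\<lambda>q. X (\<iota> q)) = nab (\<iota> p) (differential B A \<iota> p x) X"
proof -
  define c where "c = chart_at A (\<iota> p)"
  have c: "c \<in> A" "\<iota> p \<in> fst c" using chart_at_atlas[OF A] unfolding c_def by blast+
  let ?dx = "differential B A \<iota> p x"
  have dx: "?dx \<in> tangent_space A (\<iota> p)" by (rule differential_tangent[OF B A \<iota> x])
  obtain U where U: "\<iota> p \<in> U" "vector_field_on A U X"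
    using X unfolding vector_field_near_def by blast
  have oU: "open U" using U(2) unfolding vector_field_on_def by blast
  let ?V = "fst c \<inter> U"
  have V: "open ?V" "\<iota> p \<in> ?V" using oU c U(1) open_chart_domain[OF A c(1)] by auto
  have "smooth_on (\<lambda>u. X (chart_inv c u) c) (snd c ` (fst c \<inter> U))"
    using U(2) c unfolding vector_field_on_def by blast
  from smooth_on_has_derivative[OF this, of "snd c (\<iota> p)"]
  have diff: "((\<lambda>q. X q c) \<circ> chart_inv c) differentiable at (snd c (\<iota> p))"
    using V(2) by (auto intro: differentiableI simp: comp_def)
  have E: "vector_field_on A ?V (\<lambda>q. coord_vec A c q b)" for b
    by (rule vector_field_on_subset[OF vector_field_on_coord_vec[OF A c(1)] V(1)]) blast
  have f: "smooth_fun A ?V (\<lambda>q. X q c \<bullet> b)" for b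
    by (rule vector_field_on_component[OF A c(1) U(2)])
  \<comment> \<open>The expansion of \<open>X\<close> in the coordinate fields of \<open>c\<close>.
    It is known to agree with \<open>X\<close> only on \<open>?V\<close>, hence the appeal to
    \<open>connection_local\<close> below.\<close>
  let ?Y = "\<lambda>q. \<Sum>b\<in>Basis. (X q c \<bullet> b) *\<^sub>R coord_vec A c q b"
  have "vector_field_on A ?V ?Y"
    by (intro vector_field_on_sum[OF A V(1)] vector_field_on_scaleR[OF A f E])
  then have Y: "vector_field_near A (\<iota> p) ?Y" using V(2) unfolding vector_field_near_def by blast
  have rep: "coord_vec A c q u = (\<Sum>b\<in>Basis. (u \<bullet> b) *\<^sub>R coord_vec A c q b)" if "q \<in> fst c" for q u
    using linear_sum[OF linear_coord_vec[OF A c(1) that], of "\<lambda>b. (u \<bullet> b) *\<^sub>R b" Basis]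
      linear_cmul[OF linear_coord_vec[OF A c(1) that]]
    by (simp add: euclidean_representation)
  have XY: "X q = ?Y q" if "q \<in> ?V" for q
  proof -
    have "X q \<in> tangent_space A q" using that U(2) unfolding vector_field_on_def by blast
    from tangent_eq_coord_vec[OF this c(1)] rep[of q "X q c"] that show ?thesis by simp
  qed
  \<comment> \<open>By the chain rule, the coefficients of \<open>X\<close> can be differentiated on
    the submanifold instead of in the ambient manifold.\<close>
  have dd: "dir_deriv A (\<iota> p) ?dx (\<lambda>q. X q c \<bullet> b) = dir_deriv B p x (\<lambda>q. X (\<iota> q) c) \<bullet> b" for b
    unfolding dir_deriv_inner[OF A c dx diff] dir_deriv_comp_smooth_map[OF B A \<iota> x c diff] ..
  have "nab (\<iota> p) ?dx X = nab (\<iota> p) ?dx ?Y"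
    by (rule connection_local[OF A nab dx X Y V XY])
  also have "\<dots> = (\<Sum>b\<in>Basis. dir_deriv A (\<iota> p) ?dx (\<lambda>q. X q c \<bullet> b) *\<^sub>R coord_vec A c (\<iota> p) b
      + (X (\<iota> p) c \<bullet> b) *\<^sub>R nab (\<iota> p) ?dx (\<lambda>q. coord_vec A c q b))"
    by (rule connection_sum[OF A nab dx V(2,1) finite_Basis f E])
  also have "\<dots> = coord_vec A c (\<iota> p) (dir_deriv B p x (\<lambda>q. X (\<iota> q) c)) +
      (\<Sum>b\<in>Basis. (X (\<iota> p) c \<bullet> b) *\<^sub>R nab (\<iota> p) ?dx (\<lambda>q. coord_vec A c q b))"
    unfolding dd sum.distrib rep[OF c(2), of "dir_deriv B p x (\<lambda>q. X (\<iota> q) c)"] ..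
  finally show ?thesis unfolding cov_deriv_along_def c_def Let_def by (rule sym)
qed

text \<open>Every term of the defining formula is tangent at \<open>\<iota> p\<close>, whatever
  \<open>V\<close> is. This supplies the membership that \<open>normal_part_eq_0_imp_tangent\<close>
  asks for.\<close>

lemma cov_deriv_along_tangent_space:
  assumes B: "smooth_atlas B" and A: "smooth_atlas A" and \<iota>: "smooth_map B A \<iota>"
    and nab: "affine_connection A nab" and x: "x \<in> tangent_space B p"
  shows "cov_deriv_along B A nab \<iota> p x V \<in> tangent_space A (\<iota> p)"
proof -
  note c = chart_at_atlas[OF A, of "\<iota> p"]
  note sub = subspace_tangent_space[OF A, of "\<iota> p"]
  have "vector_field_near A (\<iota> p) (\<lambda>q. coord_vec A (chart_at A (\<iota> p)) q b)" for b
    using vector_field_on_coord_vec[OF A c(1)] c(2) unfolding vector_field_near_def by blast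
  from connection_tangent[OF nab differential_tangent[OF B A \<iota> x] this]
  show ?thesis
    unfolding cov_deriv_along_def Let_def
    by (intro subspace_add[OF sub] subspace_sum[OF sub] subspace_scale[OF sub]
        coord_vec_tangent[OF A c])
qed

section \<open>Tangency of covariant derivatives along totally geodesic submanifolds\<close>

text \<open>Restricting to the line through \<open>a\<close> in direction \<open>h\<close> writes
  the derivative as a limit of difference quotients, the form to which
  \<open>tendsto_in_range_of_injective_limit\<close> applies.\<close>

lemma has_derivative_directional_limit:
  assumes "(f has_derivative f') (at a)"
  shows "((\<lambda>t. (f (a + t *\<^sub>R h) - f a) /\<^sub>R t) \<longlongrightarrow> f' h) (at (0::real))"
proof -
  have "((\<lambda>t::real. a + t *\<^sub>R h) has_derivative (\<lambda>t. t *\<^sub>R h)) (at 0)"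
    by (auto intro!: derivative_eq_intros)
  from has_derivative_compose[OF this, of f f'] assms
  have "((\<lambda>t. f (a + t *\<^sub>R h)) has_derivative (\<lambda>t. f' (t *\<^sub>R h))) (at 0)" by simp
  then have "((\<lambda>t. norm (f (a + t *\<^sub>R h) - f a - t *\<^sub>R f' h) / norm t) \<longlongrightarrow> 0) (at 0)"
    by (simp add: has_derivative_at linear_cmul[OF has_derivative_linear[OF assms]])
  moreover have "norm (f (a + t *\<^sub>R h) - f a - t *\<^sub>R f' h) / norm t =
      norm ((f (a + t *\<^sub>R h) - f a) /\<^sub>R t - f' h)" if "t \<noteq> 0" for t
  proof -
    have "(f (a + t *\<^sub>R h) - f a) /\<^sub>R t - f' h = (f (a + t *\<^sub>R h) - f a - t *\<^sub>R f' h) /\<^sub>R t"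
      using that by (simp add: scaleR_diff_right)
    then show ?thesis by (simp add: divide_inverse mult.commute)
  qed
  ultimately have "((\<lambda>t. norm ((f (a + t *\<^sub>R h) - f a) /\<^sub>R t - f' h)) \<longlongrightarrow> 0) (at 0)"
    by (elim Lim_transform_eventually) (simp add: eventually_at_filter)
  then show ?thesis using LIM_zero_cancel tendsto_norm_zero_iff by blast
qed

lemma totally_geodesic_connection_tangent:
  assumes B: "smooth_atlas B" and A: "smooth_atlas A" and \<iota>: "immersion B A \<iota>"
    and g: "semi_riemannian_metric A g" and nd: "nondegenerate_submanifold B A g \<iota>"
    and nab: "affine_connection A nab" and geo: "totally_geodesic B A g nab \<iota>"
    and X: "vector_field_near A (\<iota> p) X" and tan: "\<And>q. X (\<iota> q) \<in> sub_tangent B A \<iota> q"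
    and x: "x \<in> tangent_space B p"
  shows "nab (\<iota> p) (differential B A \<iota> p x) X \<in> sub_tangent B A \<iota> p"
proof -
  have sm: "smooth_map B A \<iota>" using \<iota> unfolding immersion_def by blast
  define b where "b = chart_at B p"
  define c where "c = chart_at A (\<iota> p)"
  have b: "b \<in> B" "p \<in> fst b" using chart_at_atlas[OF B] unfolding b_def by blast+
  have c: "c \<in> A" "\<iota> p \<in> fst c" using chart_at_atlas[OF A] unfolding c_def by blast+
  note bc = b(1) c(1) b(2) c(2)
  let ?S = "snd b ` (fst b \<inter> \<iota> -` fst c)" and ?r = "snd c \<circ> \<iota> \<circ> chart_inv b"
  let ?u = "snd b p" and ?h = "x b"
  define J where "J u = frechet_derivative ?r (at u)" for u
  have S: "open ?S" "?u \<in> ?S" using open_smooth_map_chart_domain[OF B A sm bc(1,2)] bc by auto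
  have smr: "smooth_on ?r ?S" by (rule smooth_on_smooth_map_chart[OF sm bc(1,2)])
  have linJ: "linear (J u)" if "u \<in> ?S" for u
    unfolding J_def using smooth_on_has_derivative[OF smr that] has_derivative_linear by blast
  have smJ: "smooth_on (\<lambda>u. J u v) ?S" for v
    unfolding J_def by (rule smooth_on_frechet_derivative[OF smr])
  have invb: "chart_inv b ?u = p" by (rule chart_inv_chart[OF B b])
  have S_D: "chart_inv b u \<in> fst b" "\<iota> (chart_inv b u) \<in> fst c" "snd b (chart_inv b u) = u"
    if "u \<in> ?S" for u using that chart_inv_chart[OF B b(1)] by auto
  \<comment> \<open>Preimages of the values of \<open>X\<close> are chosen point by point, so
    \<open>y\<close> need not even be continuous.\<close>
  obtain y where y: "\<And>q. y q \<in> tangent_space B q" "\<And>q. X (\<iota> q) = differential B A \<iota> q (y q)"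
    using tan unfolding sub_tangent_def image_iff by metis
  define V where "V u = X (\<iota> (chart_inv b u)) c" for u
  define y' where "y' u = y (chart_inv b u) b" for u
  have V: "V u = J u (y' u)" if "u \<in> ?S" for u
    using differential_chart[OF B sm bc(1,2) S_D(1,2)[OF that] y(1)] S_D(3)[OF that]
    unfolding V_def y(2) J_def y'_def by simp
  \<comment> \<open>The coordinate field whose coefficients are frozen at those of \<open>y\<close>
    at \<open>p\<close>. It is smooth near \<open>p\<close>, so the totally geodesic condition
    applies to it.\<close>
  define Y where "Y q = coord_vec B b q (y' ?u)" for q
  have Y: "vector_field_near B p Y"
    unfolding vector_field_near_def Y_def using vector_field_on_coord_vec[OF B b(1)] b(2) by blast
  define W where "W u = differential B A \<iota> (chart_inv b u) (Y (chart_inv b u)) c" for u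
  have W: "W u = J u (y' ?u)" if "u \<in> ?S" for u
    unfolding W_def Y_def J_def
      differential_chart[OF B sm bc(1,2) S_D(1,2)[OF that] coord_vec_tangent[OF B b(1) S_D(1)[OF that]]]
      coord_vec_self[OF B b(1) S_D(1)[OF that]] S_D(3)[OF that] ..
  have diffV: "V differentiable at ?u"
  proof -
    obtain U where U: "\<iota> p \<in> U" "vector_field_on A U X"
      using X unfolding vector_field_near_def by blast
    have "smooth_on (\<lambda>u. X (chart_inv c u) c) (snd c ` (fst c \<inter> U))"
      using U(2) c unfolding vector_field_on_def by blast
    from smooth_on_has_derivative[OF this, of "snd c (\<iota> p)"]
    have "((\<lambda>q. X q c) \<circ> chart_inv c) differentiable at (snd c (\<iota> p))"
      using U(1) c(2) by (auto intro: differentiableI simp: comp_def)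
    from smooth_map_chain_rule(1)[OF B A sm bc this]
    show ?thesis unfolding V_def comp_def .
  qed
  have diffW: "W differentiable at ?u"
    by (rule has_derivative_frechet_cong(1)[OF smooth_on_has_derivative[OF smJ S(2)] S])
      (simp add: W)
  let ?DV = "frechet_derivative V (at ?u) ?h" and ?DW = "frechet_derivative W (at ?u) ?h"
  \<comment> \<open>As \<open>V - W\<close> vanishes at \<open>?u\<close>, its difference quotients
    near \<open>?u\<close> are \<open>J (?u + t *\<^sub>R ?h)\<close> applied to
    \<open>(y' (?u + t *\<^sub>R ?h) - y' ?u) /\<^sub>R t\<close>. Their limit lies in the range of
    \<open>J ?u\<close> although these arguments are not known to converge.\<close>
  have "?DV - ?DW \<in> range (J ?u)"
  proof (rule tendsto_in_range_of_injective_limit)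
    have line: "((\<lambda>t. ?u + t *\<^sub>R ?h) \<longlongrightarrow> ?u) (at (0::real))"
      by (auto intro!: tendsto_eq_intros)
    then have ev: "eventually (\<lambda>t. ?u + t *\<^sub>R ?h \<in> ?S) (at (0::real))"
      using topological_tendstoD[OF _ S] by blast
    then show "eventually (\<lambda>t. linear (J (?u + t *\<^sub>R ?h))) (at (0::real))"
      by (rule eventually_mono) (rule linJ)
    show "linear (J ?u)" by (rule linJ[OF S(2)])
    show "inj (J ?u)" unfolding J_def by (rule inj_frechet_derivative_immersion[OF B A \<iota> bc])
    show "((\<lambda>t. J (?u + t *\<^sub>R ?h) v) \<longlongrightarrow> J ?u v) (at (0::real))" for v
      by (rule isCont_tendsto_compose[OF _ line])
        (rule has_derivative_continuous[OF smooth_on_has_derivative[OF smJ S(2)]])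
    have "((\<lambda>u. V u - W u) has_derivative
        (\<lambda>v. frechet_derivative V (at ?u) v - frechet_derivative W (at ?u) v)) (at ?u)"
      using diffV diffW unfolding frechet_derivative_works by (rule has_derivative_diff)
    from has_derivative_directional_limit[OF this, of ?h]
    show "((\<lambda>t. J (?u + t *\<^sub>R ?h) ((y' (?u + t *\<^sub>R ?h) - y' ?u) /\<^sub>R t)) \<longlongrightarrow> ?DV - ?DW)
        (at (0::real))"
      by (rule Lim_transform_eventually)
        (use ev in eventually_elim, simp add: V W S(2) linear_cmul[OF linJ] linear_diff[OF linJ])
  qed simp
  then obtain z where z: "?DV - ?DW = J ?u z" by blast
  \<comment> \<open>The two fields have the same value at \<open>p\<close>, so the connection terms
    in \<open>cov_deriv_along\<close> coincide and only the derivatives of the coefficients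
    differ.\<close>
  have VW: "X (\<iota> p) c = differential B A \<iota> p (Y p) c"
    using V[OF S(2)] W[OF S(2)] unfolding V_def W_def invb by simp
  have DV: "dir_deriv B p x (\<lambda>q. X (\<iota> q) c) = ?DV"
    unfolding dir_deriv_def Let_def b_def[symmetric] V_def comp_def ..
  have DW: "dir_deriv B p x (\<lambda>q. differential B A \<iota> q (Y q) c) = ?DW"
    unfolding dir_deriv_def Let_def b_def[symmetric] W_def comp_def ..
  let ?cY = "cov_deriv_along B A nab \<iota> p x (\<lambda>q. differential B A \<iota> q (Y q))"
  have "?DV = ?DW + J ?u z" using z by (simp add: algebra_simps)
  then have split: "coord_vec A c (\<iota> p) ?DV = coord_vec A c (\<iota> p) ?DW + coord_vec A c (\<iota> p) (J ?u z)"
    using linear_add[OF linear_coord_vec[OF A c]] by simp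
  have "cov_deriv_along B A nab \<iota> p x (\<lambda>q. X (\<iota> q)) = ?cY + coord_vec A c (\<iota> p) (J ?u z)"
    unfolding cov_deriv_along_def Let_def c_def[symmetric] DV DW VW split
    by (simp only: add.assoc add.commute)
  moreover have "?cY \<in> sub_tangent B A \<iota> p"
  proof (rule normal_part_eq_0_imp_tangent[OF B A \<iota> g nd cov_deriv_along_tangent_space[OF B A sm nab x]])
    show "normal_part B A g \<iota> p ?cY = 0"
      using geo x Y unfolding totally_geodesic_def second_fundamental_form_def by blast
  qed
  moreover have "coord_vec A c (\<iota> p) (J ?u z) \<in> sub_tangent B A \<iota> p"
    unfolding sub_tangent_eq_range[OF B A sm bc] J_def by blast
  ultimately show ?thesis
    using subspace_add[OF subspace_sub_tangent[OF B A sm]]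
    unfolding cov_deriv_along_restriction[OF B A sm nab X x] by simp
qed

section \<open>Mixed 3-Sasakian structures\<close>

text \<open>The formula for the square of \<phi> sends \<xi> to 0. Applied to the image of \<xi>
  under \<phi>, it forces that image to be a multiple \<open>k\<close> of \<xi>; then
  \<open>k * k = 0\<close>, because \<eta> takes the value 1 on \<xi>.\<close>

lemma mixed_3_structure_\<phi>_\<xi>:
  assumes A: "smooth_atlas A" and m: "mixed_3_structure A \<phi> \<xi> \<eta>" and \<alpha>: "\<alpha> \<in> {1, 2, 3}"
  shows "\<phi> \<alpha> p (\<xi> \<alpha> p) = 0"
proof -
  let ?F = "\<phi> \<alpha> p" and ?x = "\<xi> \<alpha> p" and ?n = "\<eta> \<alpha> p"
  have tf: "tensor_field_11 A (\<phi> \<alpha>)" and vf: "vector_field_on A UNIV (\<xi> \<alpha>)"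
    and of: "one_form A (\<eta> \<alpha>)" and n1: "?n ?x = 1"
    and sq: "\<forall>v\<in>tangent_space A p. ?F (?F v) = \<tau> \<alpha> *\<^sub>R (- v + ?n v *\<^sub>R ?x)"
    using m \<alpha> unfolding mixed_3_structure_def by blast+
  have x: "?x \<in> tangent_space A p" using vf unfolding vector_field_on_def by blast
  have Fx: "?F ?x \<in> tangent_space A p" using tf x unfolding tensor_field_11_def by blast
  have Fr: "?F (r *\<^sub>R v) = r *\<^sub>R ?F v" if "v \<in> tangent_space A p" for r v
    using tf that unfolding tensor_field_11_def by blast
  have nr: "?n (r *\<^sub>R ?x) = r" for r
    using of x n1 unfolding one_form_def by simp
  have "\<tau> \<alpha> \<noteq> 0" by (simp add: \<tau>_def)
  have FFx: "?F (?F ?x) = 0" using sq[rule_format, OF x] n1 by simp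
  \<comment> \<open>Homogeneity with factor 0 shows that \<open>?F\<close> maps 0 to 0.\<close>
  then have "?F (?F (?F ?x)) = 0" using Fr[OF x, of 0] by simp
  with sq[rule_format, OF Fx] \<open>\<tau> \<alpha> \<noteq> 0\<close> have Fx_eq: "?F ?x = ?n (?F ?x) *\<^sub>R ?x"
    by (simp add: add.commute[of "- _"])
  define k where "k = ?n (?F ?x)"
  have Fk: "?F ?x = k *\<^sub>R ?x" using Fx_eq unfolding k_def .
  have "(k * k) *\<^sub>R ?x = 0" using FFx Fr[OF x, of k] unfolding Fk by (simp add: Fk)
  then have "k * k = 0" using nr[of "k * k"] nr[of 0] by (simp only: scaleR_zero_left)
  then show ?thesis using Fk by simp
qed

text \<open>The coefficient of \<xi> is not evaluated: for tangency it only matters that the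
  right-hand side is a combination of \<xi> and its covariant derivative.\<close>

lemma mixed_3_sasakian_\<phi>_eq:
  assumes A: "smooth_atlas A" and s: "mixed_3_sasakian A \<phi> \<xi> \<eta> g nab" and \<alpha>: "\<alpha> \<in> {1, 2, 3}"
    and x: "x \<in> tangent_space A p"
  shows "\<phi> \<alpha> p x = g p (\<xi> \<alpha> p) (\<xi> \<alpha> p) *\<^sub>R
    (\<eta> \<alpha> p (nab p x (\<xi> \<alpha>)) *\<^sub>R \<xi> \<alpha> p - nab p x (\<xi> \<alpha>))"
proof -
  let ?F = "\<phi> \<alpha> p" and ?\<xi> = "\<xi> \<alpha> p" and ?N = "nab p x (\<xi> \<alpha>)"
  define \<epsilon> where "\<epsilon> = g p ?\<xi> ?\<xi>"
  note sub = subspace_tangent_space[OF A, of p]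
  have m: "mixed_3_structure A \<phi> \<xi> \<eta>" and nab: "affine_connection A nab"
    using s unfolding mixed_3_sasakian_def metric_mixed_3_structure_def levi_civita_def by blast+
  have "\<epsilon> \<in> {1, - 1}"
    using s \<alpha> unfolding mixed_3_sasakian_def metric_mixed_3_structure_def \<epsilon>_def by blast
  then have \<epsilon>: "\<epsilon> * \<epsilon> = 1" by auto
  have tf: "tensor_field_11 A (\<phi> \<alpha>)" and vf: "vector_field_on A UNIV (\<xi> \<alpha>)"
    and n1: "\<eta> \<alpha> p ?\<xi> = 1"
    and sq: "\<forall>v\<in>tangent_space A p. ?F (?F v) = \<tau> \<alpha> *\<^sub>R (- v + \<eta> \<alpha> p v *\<^sub>R ?\<xi>)"
    using m \<alpha> unfolding mixed_3_structure_def by blast+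
  have \<xi>: "?\<xi> \<in> tangent_space A p" using vf unfolding vector_field_on_def by blast
  have near: "vector_field_near A p (\<xi> \<alpha>)" using vf unfolding vector_field_near_def by blast
  have N: "?N \<in> tangent_space A p" by (rule connection_tangent[OF nab x near])
  have FT: "?F v \<in> tangent_space A p" if "v \<in> tangent_space A p" for v
    using tf that unfolding tensor_field_11_def by blast
  have Fr: "?F (r *\<^sub>R v) = r *\<^sub>R ?F v" if "v \<in> tangent_space A p" for r v
    using tf that unfolding tensor_field_11_def by blast
  have Fa: "?F (v + w) = ?F v + ?F w" if "v \<in> tangent_space A p" "w \<in> tangent_space A p" for v w
    using tf that unfolding tensor_field_11_def by blast
  have \<phi>\<xi>: "\<phi> \<alpha> q (\<xi> \<alpha> q) = 0" for q by (rule mixed_3_structure_\<phi>_\<xi>[OF A m \<alpha>])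
  have "cov_deriv_11 nab (\<phi> \<alpha>) p x (\<xi> \<alpha>) =
      \<tau> \<alpha> *\<^sub>R (g p x ?\<xi> *\<^sub>R ?\<xi> - (g p ?\<xi> ?\<xi> * \<eta> \<alpha> p ?\<xi>) *\<^sub>R x)"
    using s \<alpha> x near unfolding mixed_3_sasakian_def by blast
  \<comment> \<open>The field obtained by applying \<phi> to \<xi> vanishes identically, so only the
    second term of \<open>cov_deriv_11\<close> survives.\<close>
  then have "- ?F ?N = \<tau> \<alpha> *\<^sub>R (g p x ?\<xi> *\<^sub>R ?\<xi> - \<epsilon> *\<^sub>R x)"
    unfolding cov_deriv_11_def \<phi>\<xi> connection_zero[OF A nab x] n1 \<epsilon>_def
    by (simp only: diff_0 mult_1_right)
  then have "?F ?N = (- \<tau> \<alpha>) *\<^sub>R (g p x ?\<xi> *\<^sub>R ?\<xi> + (- \<epsilon>) *\<^sub>R x)"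
    by (simp add: minus_equation_iff[of "?F ?N"])
  \<comment> \<open>A second application of \<phi> kills the \<xi> term and leaves a multiple of
    \<open>?F x\<close>.\<close>
  moreover have "?F (g p x ?\<xi> *\<^sub>R ?\<xi> + (- \<epsilon>) *\<^sub>R x) = (- \<epsilon>) *\<^sub>R ?F x"
    unfolding Fa[OF subspace_scale[OF sub \<xi>] subspace_scale[OF sub x]] Fr[OF \<xi>] Fr[OF x] \<phi>\<xi>
    by (simp only: scaleR_zero_right add_0_left)
  ultimately have "?F (?F ?N) = (- \<tau> \<alpha>) *\<^sub>R (- \<epsilon>) *\<^sub>R ?F x"
    by (simp only: Fr[OF subspace_add[OF sub subspace_scale[OF sub \<xi>] subspace_scale[OF sub x]]])
  with sq[rule_format, OF N]
  have "\<tau> \<alpha> *\<^sub>R (- ?N + \<eta> \<alpha> p ?N *\<^sub>R ?\<xi>) = \<tau> \<alpha> *\<^sub>R \<epsilon> *\<^sub>R ?F x" by simp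
  moreover have "\<tau> \<alpha> \<noteq> 0" by (simp add: \<tau>_def)
  ultimately have "\<epsilon> *\<^sub>R ?F x = \<eta> \<alpha> p ?N *\<^sub>R ?\<xi> - ?N"
    by (simp only: scaleR_cancel_left) (simp add: add.commute)
  \<comment> \<open>As \<open>\<epsilon> * \<epsilon> = 1\<close>, multiplying by \<epsilon>
    isolates \<open>?F x\<close>.\<close>
  then have "\<epsilon> *\<^sub>R \<epsilon> *\<^sub>R ?F x = \<epsilon> *\<^sub>R (\<eta> \<alpha> p ?N *\<^sub>R ?\<xi> - ?N)" by simp
  then show ?thesis using \<epsilon> unfolding \<epsilon>_def by simp
qed

theorem corollary3p10:
  fixes A :: "('m::{t2_space,second_countable_topology}, 'e::euclidean_space) chart set"
    and \<phi> :: "nat \<Rightarrow> 'm \<Rightarrow> ('m, 'e) tvec \<Rightarrow> ('m, 'e) tvec"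
    and \<xi> :: "nat \<Rightarrow> 'm \<Rightarrow> ('m, 'e) tvec"
    and \<eta> :: "nat \<Rightarrow> 'm \<Rightarrow> ('m, 'e) tvec \<Rightarrow> real"
    and g :: "'m \<Rightarrow> ('m, 'e) tvec \<Rightarrow> ('m, 'e) tvec \<Rightarrow> real"
    and nab :: "('m, 'e) conn"
    and B :: "('n::{t2_space,second_countable_topology}, 'f::euclidean_space) chart set"
    and \<iota> :: "'n \<Rightarrow> 'm"
  assumes "smooth_atlas A"
    and "mixed_3_sasakian A \<phi> \<xi> \<eta> g nab"
    and "smooth_atlas B"
    and "immersion B A \<iota>"
    and "nondegenerate_submanifold B A g \<iota>"
    and "totally_geodesic B A g nab \<iota>"
    and "tangent_to_structure B A \<xi> \<iota>"
  shows "invariant_submanifold B A \<phi> \<iota>"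
  unfolding invariant_submanifold_def
proof (intro allI ballI subsetI)
  fix p \<alpha> v assume \<alpha>: "\<alpha> \<in> {1, 2, 3 :: nat}" and "v \<in> \<phi> \<alpha> (\<iota> p) ` sub_tangent B A \<iota> p"
  then obtain x where x: "x \<in> tangent_space B p" and v: "v = \<phi> \<alpha> (\<iota> p) (differential B A \<iota> p x)"
    unfolding sub_tangent_def by blast
  have sm: "smooth_map B A \<iota>" using assms(4) unfolding immersion_def by blast
  have g: "semi_riemannian_metric A g" and nab: "affine_connection A nab"
    and "mixed_3_structure A \<phi> \<xi> \<eta>"
    using assms(2) unfolding mixed_3_sasakian_def metric_mixed_3_structure_def levi_civita_def
    by blast+
  then have "vector_field_on A UNIV (\<xi> \<alpha>)" using \<alpha> unfolding mixed_3_structure_def by blast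
  then have near: "vector_field_near A (\<iota> p) (\<xi> \<alpha>)" unfolding vector_field_near_def by blast
  have tan: "\<xi> \<alpha> (\<iota> q) \<in> sub_tangent B A \<iota> q" for q
    using assms(7) \<alpha> unfolding tangent_to_structure_def by blast
  have N: "nab (\<iota> p) (differential B A \<iota> p x) (\<xi> \<alpha>) \<in> sub_tangent B A \<iota> p"
    by (rule totally_geodesic_connection_tangent[OF assms(3,1,4) g assms(5) nab assms(6) near tan x])
  note sub = subspace_sub_tangent[OF assms(3,1) sm, of p]
  show "v \<in> sub_tangent B A \<iota> p"
    \<comment> \<open>Both vectors in this combination are tangent to the submanifold: \<xi> by
      hypothesis and its covariant derivative by \<open>N\<close>.\<close>
    unfolding v mixed_3_sasakian_\<phi>_eq[OF assms(1,2) \<alpha> differential_tangent[OF assms(3,1) sm x]]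
    by (intro subspace_scale[OF sub] subspace_diff[OF sub] tan N)
qed

end
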